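(* Let $A$ be a regular $G$-anneid with grading set $\Delta$. The Jacobson radical of $A$ consists of exactly those elements $x\in A$ such that, for every $0\neq\alpha\in G$ and every $\alpha$-idempotent $e\in\Delta$, $$xGA\cap A(e)\subseteq J(A(e)),$$ where $J(A(e))$ is the Jacobson radical of the $G(\alpha)$-ring $A(e)$.
   Context: A commutative homogroupoid is a set $H$ with a commutative partial operation $+$ (write $x\#y$, "$x,y$ are addable", if $x+y$ is defined) such that: there is $0\in H$ with $x\#0$ and $x+0=x$ for all $x$; $x\#x$ for all $x$; if $x\#y$, $y\#z$ and $y\neq0$ then $x\#z$; and for each $a\neq0$ the set $H(a)=\{x\in H: a\#x\}$ is a group under $+$ (an addibility group). A $G$-anneid $A$ consists of commutative homogroupoids $A$ and $G$ and an everywhere defined map $A\times G\times A\to A$, $(a,\gamma,b)\mapsto a\gamma b$, such that: $a\#a'$ implies $a\gamma b\#a'\gamma b$ and $(a+a')\gamma b=a\gamma b+a'\gamma b$; $\gamma\#\gamma'$ implies $a\gamma b\#a\gamma' b$ and $a(\gamma+\gamma')b=a\gamma b+a\gamma' b$; $b\#b'$ implies $a\gamma b\#a\gamma b'$ and $a\gamma(b+b')=a\gamma b+a\gamma b'$; and $(a\gamma b)\beta c=a\gamma(b\beta c)$. Notation such as $xGA$ denotes the set of all products $x\alpha a$ with $\alpha\in G$, $a\in A$. Degrees: $\Delta^*$ is the set of addibility groups $A(a)$, $a\ne0$, of $A$, and $D^*$ the set of addibility groups of $G$; $\Delta=\Delta^*\cup\{0\}$, $D=D^*\cup\{0\}$.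 For $0\neq a\in A$ its degree $\delta(a)\in\Delta^*$ is the element corresponding to $A(a)$, and $\delta(0)=0$; $A_\xi=A(\xi)$ denotes the subgroup corresponding to $\xi\in\Delta$ (with $A_0=\{0\}$). Likewise $d(\alpha)\in D$ is the degree of $\alpha\in G$, and $G_d$ is the subgroup corresponding to $d$; $G(\alpha)$ is the addibility group of $\alpha\neq0$. For $\xi,\eta\in\Delta$, $d\in D$, the product $\xi d\eta\in\Delta$ is the unique $\zeta$ with $A_\xi G_dA_\eta\subseteq A_\zeta$ if $A_\xi G_dA_\eta\neq\{0\}$, and $\xi d\eta=0$ otherwise. For $0\ne\alpha\in G$, $e\in\Delta$ is an $\alpha$-idempotent if $e\,d(\alpha)\,e=e$; then $A(e)$ is a $G(\alpha)$-ring. A (right) $AG$-moduloid is a commutative homogroupoid $M$ with a map $M\times G\times A\to M$, $(w,\alpha,x)\mapsto w\alpha x$, such that $x\#y$ implies $w\alpha x\#w\alpha y$ and $w\alpha(x+y)=w\alpha x+w\alpha y$; $w\#w'$ implies $w\alpha x\#w'\alpha x$ and $(w+w')\alpha x=w\alpha x+w'\alpha x$; and $w\beta(x\alpha y)=(w\beta x)\alpha y$. It is regular if for all $x\in M$, $\alpha,\beta\in G$, $a,b\in A$: $0\neq x\alpha a\#x\beta b\neq0$ implies $\alpha\#\beta$ and $a\#b$. Left moduloids and their regularity are defined symmetrically. $A$ is regular if it is regular both as a right and as a left $AG$-moduloid. A submoduloid of $M$ is a nonempty $N\subseteq M$ such that $x,y\in N$, $x\#y$ imply $x-y\in N$, and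 $x\alpha a\in N$ for all $x\in N$, $\alpha\in G$, $a\in A$. $M$ is irreducible if $MGA\ne\{0\}$ and $M$ has no nontrivial submoduloids. The annihilator of $M$ is $(0:M)=\{a\in A: MGa=\{0\}\}$. The Jacobson radical $J(A)$ of $A$ is the intersection of the annihilators of all irreducible regular $AG$-moduloids. A $\Gamma$-ring is a pair of abelian groups $R,\Gamma$ with a map $R\times\Gamma\times R\to R$, additive in each variable, with $(x\alpha y)\beta z=x\alpha(y\beta z)$. A right $R\Gamma$-module is an abelian group $V$ with a map $V\times\Gamma\times R\to V$, additive in each variable, with $(v\alpha x)\beta y=v\alpha(x\beta y)$; it is irreducible if $V\Gamma R\neq\{0\}$ and it has no nontrivial submodules. The Jacobson radical $J(R)$ of a $\Gamma$-ring $R$ is the intersection of the annihilators $\{a\in R: V\Gamma a=\{0\}\}$ of all irreducible right $R\Gamma$-modules $V$. *)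

theory Defs
  imports "HOL-Algebra.Group"
begin

section \<open>Commutative homogroupoids\<close>

text \<open>
  The partial operation is a total function that is only meaningful on addable pairs.
\<close>

record 'a homogroupoid = "'a partial_object" +
  addable :: "'a \<Rightarrow> 'a \<Rightarrow> bool" (infix "\<sharp>\<index>" 50)
  hadd :: "'a \<Rightarrow> 'a \<Rightarrow> 'a" (infixl "\<boxplus>\<index>" 65)
  hzero :: 'a

definition addible_set :: "'a homogroupoid \<Rightarrow> 'a \<Rightarrow> 'a set" where
  "addible_set H a = {x \<in> carrier H. a \<sharp>\<^bsub>H\<^esub> x}"

text \<open>
  The operation of \<open>H\<close> on a set of pairwise addable elements, as a (multiplicatively written)
  structure of HOL-Algebra.
\<close>

definition on_set :: "'a homogroupoid \<Rightarrow> 'a set \<Rightarrow> 'a monoid" where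
  "on_set H S = \<lparr>carrier = S, mult = hadd H, one = hzero H\<rparr>"

locale homogroupoid =
  fixes H :: "'a homogroupoid" (structure)
  assumes zero_closed: "hzero H \<in> carrier H"
    and add_closed: "\<lbrakk>x \<in> carrier H; y \<in> carrier H; x \<sharp> y\<rbrakk> \<Longrightarrow> x \<boxplus> y \<in> carrier H"
    and addable_sym: "\<lbrakk>x \<in> carrier H; y \<in> carrier H; x \<sharp> y\<rbrakk> \<Longrightarrow> y \<sharp> x"
    and add_commute: "\<lbrakk>x \<in> carrier H; y \<in> carrier H; x \<sharp> y\<rbrakk> \<Longrightarrow> x \<boxplus> y = y \<boxplus> x"
    and addable_zero: "x \<in> carrier H \<Longrightarrow> x \<sharp> hzero H"
    and add_zero: "x \<in> carrier H \<Longrightarrow> x \<boxplus> hzero H = x"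
    and addable_refl: "x \<in> carrier H \<Longrightarrow> x \<sharp> x"
    and addable_trans: "\<lbrakk>x \<in> carrier H; y \<in> carrier H; z \<in> carrier H; x \<sharp> y; y \<sharp> z; y \<noteq> hzero H\<rbrakk>
           \<Longrightarrow> x \<sharp> z"
    and addibility_group: "\<lbrakk>a \<in> carrier H; a \<noteq> hzero H\<rbrakk> \<Longrightarrow> group (on_set H (addible_set H a))"

definition hneg :: "'a homogroupoid \<Rightarrow> 'a \<Rightarrow> 'a" where
  "hneg H y = (THE z. z \<in> carrier H \<and> y \<sharp>\<^bsub>H\<^esub> z \<and> y \<boxplus>\<^bsub>H\<^esub> z = hzero H)"

definition hdiff :: "'a homogroupoid \<Rightarrow> 'a \<Rightarrow> 'a \<Rightarrow> 'a" where
  "hdiff H x y = x \<boxplus>\<^bsub>H\<^esub> hneg H y"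

text \<open>
  A degree is represented by the subgroup it stands for, and the degree 0 by \<open>{0}\<close>; thus both
  \<open>\<Delta>\<close> and \<open>D\<close> are instances of \<open>degrees\<close>, and \<open>A(\<xi>)\<close> is \<open>\<xi>\<close> itself.
\<close>

definition degrees :: "'a homogroupoid \<Rightarrow> 'a set set" where
  "degrees H = insert {hzero H} {addible_set H a | a. a \<in> carrier H \<and> a \<noteq> hzero H}"

definition degree :: "'a homogroupoid \<Rightarrow> 'a \<Rightarrow> 'a set" where
  "degree H a = (if a = hzero H then {hzero H} else addible_set H a)"

definition products :: "('x \<Rightarrow> 'y \<Rightarrow> 'z \<Rightarrow> 'w) \<Rightarrow> 'x set \<Rightarrow> 'y set \<Rightarrow> 'z set \<Rightarrow> 'w set" where
  "products f X Y Z = {f x y z | x y z. x \<in> X \<and> y \<in> Y \<and> z \<in> Z}"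


section \<open>Anneids and moduloids\<close>

locale anneid =
  A: homogroupoid A + G: homogroupoid G
  for A :: "'a homogroupoid" and G :: "'g homogroupoid" and mul :: "'a \<Rightarrow> 'g \<Rightarrow> 'a \<Rightarrow> 'a" +
  assumes mul_closed: "\<lbrakk>a \<in> carrier A; \<gamma> \<in> carrier G; b \<in> carrier A\<rbrakk> \<Longrightarrow> mul a \<gamma> b \<in> carrier A"
    and mul_left: "\<lbrakk>a \<in> carrier A; a' \<in> carrier A; \<gamma> \<in> carrier G; b \<in> carrier A; a \<sharp>\<^bsub>A\<^esub> a'\<rbrakk>
        \<Longrightarrow> mul a \<gamma> b \<sharp>\<^bsub>A\<^esub> mul a' \<gamma> b \<and> mul (a \<boxplus>\<^bsub>A\<^esub> a') \<gamma> b = mul a \<gamma> b \<boxplus>\<^bsub>A\<^esub> mul a' \<gamma> b"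
    and mul_mid: "\<lbrakk>a \<in> carrier A; \<gamma> \<in> carrier G; \<gamma>' \<in> carrier G; b \<in> carrier A; \<gamma> \<sharp>\<^bsub>G\<^esub> \<gamma>'\<rbrakk>
        \<Longrightarrow> mul a \<gamma> b \<sharp>\<^bsub>A\<^esub> mul a \<gamma>' b \<and> mul a (\<gamma> \<boxplus>\<^bsub>G\<^esub> \<gamma>') b = mul a \<gamma> b \<boxplus>\<^bsub>A\<^esub> mul a \<gamma>' b"
    and mul_right: "\<lbrakk>a \<in> carrier A; \<gamma> \<in> carrier G; b \<in> carrier A; b' \<in> carrier A; b \<sharp>\<^bsub>A\<^esub> b'\<rbrakk>
        \<Longrightarrow> mul a \<gamma> b \<sharp>\<^bsub>A\<^esub> mul a \<gamma> b' \<and> mul a \<gamma> (b \<boxplus>\<^bsub>A\<^esub> b') = mul a \<gamma> b \<boxplus>\<^bsub>A\<^esub> mul a \<gamma> b'"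
    and mul_assoc: "\<lbrakk>a \<in> carrier A; \<gamma> \<in> carrier G; b \<in> carrier A; \<beta> \<in> carrier G; c \<in> carrier A\<rbrakk>
        \<Longrightarrow> mul (mul a \<gamma> b) \<beta> c = mul a \<gamma> (mul b \<beta> c)"

locale right_moduloid =
  anneid A G mul + M: homogroupoid M
  for A :: "'a homogroupoid" and G :: "'g homogroupoid" and mul :: "'a \<Rightarrow> 'g \<Rightarrow> 'a \<Rightarrow> 'a"
    and M :: "'m homogroupoid" and act :: "'m \<Rightarrow> 'g \<Rightarrow> 'a \<Rightarrow> 'm" +
  assumes act_closed: "\<lbrakk>w \<in> carrier M; \<alpha> \<in> carrier G; x \<in> carrier A\<rbrakk> \<Longrightarrow> act w \<alpha> x \<in> carrier M"
    and act_right: "\<lbrakk>w \<in> carrier M; \<alpha> \<in> carrier G; x \<in> carrier A; y \<in> carrier A; x \<sharp>\<^bsub>A\<^esub> y\<rbrakk>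
        \<Longrightarrow> act w \<alpha> x \<sharp>\<^bsub>M\<^esub> act w \<alpha> y \<and> act w \<alpha> (x \<boxplus>\<^bsub>A\<^esub> y) = act w \<alpha> x \<boxplus>\<^bsub>M\<^esub> act w \<alpha> y"
    and act_left: "\<lbrakk>w \<in> carrier M; w' \<in> carrier M; \<alpha> \<in> carrier G; x \<in> carrier A; w \<sharp>\<^bsub>M\<^esub> w'\<rbrakk>
        \<Longrightarrow> act w \<alpha> x \<sharp>\<^bsub>M\<^esub> act w' \<alpha> x \<and> act (w \<boxplus>\<^bsub>M\<^esub> w') \<alpha> x = act w \<alpha> x \<boxplus>\<^bsub>M\<^esub> act w' \<alpha> x"
    and act_assoc: "\<lbrakk>w \<in> carrier M; \<beta> \<in> carrier G; x \<in> carrier A; \<alpha> \<in> carrier G; y \<in> carrier A\<rbrakk>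
        \<Longrightarrow> act w \<beta> (mul x \<alpha> y) = act (act w \<beta> x) \<alpha> y"

locale left_moduloid =
  anneid A G mul + M: homogroupoid M
  for A :: "'a homogroupoid" and G :: "'g homogroupoid" and mul :: "'a \<Rightarrow> 'g \<Rightarrow> 'a \<Rightarrow> 'a"
    and M :: "'m homogroupoid" and act :: "'a \<Rightarrow> 'g \<Rightarrow> 'm \<Rightarrow> 'm" +
  assumes act_closed: "\<lbrakk>x \<in> carrier A; \<alpha> \<in> carrier G; w \<in> carrier M\<rbrakk> \<Longrightarrow> act x \<alpha> w \<in> carrier M"
    and act_left: "\<lbrakk>x \<in> carrier A; y \<in> carrier A; \<alpha> \<in> carrier G; w \<in> carrier M; x \<sharp>\<^bsub>A\<^esub> y\<rbrakk>
        \<Longrightarrow> act x \<alpha> w \<sharp>\<^bsub>M\<^esub> act y \<alpha> w \<and> act (x \<boxplus>\<^bsub>A\<^esub> y) \<alpha> w = act x \<alpha> w \<boxplus>\<^bsub>M\<^esub> act y \<alpha> w"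
    and act_right: "\<lbrakk>x \<in> carrier A; \<alpha> \<in> carrier G; w \<in> carrier M; w' \<in> carrier M; w \<sharp>\<^bsub>M\<^esub> w'\<rbrakk>
        \<Longrightarrow> act x \<alpha> w \<sharp>\<^bsub>M\<^esub> act x \<alpha> w' \<and> act x \<alpha> (w \<boxplus>\<^bsub>M\<^esub> w') = act x \<alpha> w \<boxplus>\<^bsub>M\<^esub> act x \<alpha> w'"
    and act_assoc: "\<lbrakk>x \<in> carrier A; \<alpha> \<in> carrier G; y \<in> carrier A; \<beta> \<in> carrier G; w \<in> carrier M\<rbrakk>
        \<Longrightarrow> act (mul x \<alpha> y) \<beta> w = act x \<alpha> (act y \<beta> w)"

locale regular_right_moduloid = right_moduloid +
  assumes regular:
    "\<lbrakk>x \<in> carrier M; \<alpha> \<in> carrier G; \<beta> \<in> carrier G; a \<in> carrier A; b \<in> carrier A;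
      act x \<alpha> a \<noteq> hzero M; act x \<beta> b \<noteq> hzero M; act x \<alpha> a \<sharp>\<^bsub>M\<^esub> act x \<beta> b\<rbrakk>
     \<Longrightarrow> \<alpha> \<sharp>\<^bsub>G\<^esub> \<beta> \<and> a \<sharp>\<^bsub>A\<^esub> b"

locale regular_left_moduloid = left_moduloid +
  assumes regular:
    "\<lbrakk>x \<in> carrier M; \<alpha> \<in> carrier G; \<beta> \<in> carrier G; a \<in> carrier A; b \<in> carrier A;
      act a \<alpha> x \<noteq> hzero M; act b \<beta> x \<noteq> hzero M; act a \<alpha> x \<sharp>\<^bsub>M\<^esub> act b \<beta> x\<rbrakk>
     \<Longrightarrow> \<alpha> \<sharp>\<^bsub>G\<^esub> \<beta> \<and> a \<sharp>\<^bsub>A\<^esub> b"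

definition regular_anneid ::
    "'a homogroupoid \<Rightarrow> 'g homogroupoid \<Rightarrow> ('a \<Rightarrow> 'g \<Rightarrow> 'a \<Rightarrow> 'a) \<Rightarrow> bool" where
  "regular_anneid A G mul \<longleftrightarrow>
     anneid A G mul \<and> regular_right_moduloid A G mul A mul \<and> regular_left_moduloid A G mul A mul"

definition submoduloid ::
    "'a homogroupoid \<Rightarrow> 'g homogroupoid \<Rightarrow> 'm homogroupoid \<Rightarrow> ('m \<Rightarrow> 'g \<Rightarrow> 'a \<Rightarrow> 'm) \<Rightarrow> 'm set \<Rightarrow> bool" where
  "submoduloid A G M act N \<longleftrightarrow>
     N \<noteq> {} \<and> N \<subseteq> carrier M \<and>
     (\<forall>x\<in>N. \<forall>y\<in>N. x \<sharp>\<^bsub>M\<^esub> y \<longrightarrow> hdiff M x y \<in> N) \<and>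
     (\<forall>x\<in>N. \<forall>\<alpha>\<in>carrier G. \<forall>a\<in>carrier A. act x \<alpha> a \<in> N)"

locale irreducible_right_moduloid = right_moduloid +
  assumes nontrivial_action: "products act (carrier M) (carrier G) (carrier A) \<noteq> {hzero M}"
    and irreducible: "submoduloid A G M act N \<Longrightarrow> N = {hzero M} \<or> N = carrier M"

definition moduloid_annihilator ::
    "'a homogroupoid \<Rightarrow> 'g homogroupoid \<Rightarrow> 'm homogroupoid \<Rightarrow> ('m \<Rightarrow> 'g \<Rightarrow> 'a \<Rightarrow> 'm) \<Rightarrow> 'a set" where
  "moduloid_annihilator A G M act =
     {a \<in> carrier A. products act (carrier M) (carrier G) {a} = {hzero M}}"

text \<open>
  HOL cannot quantify over moduloids of all types. The type \<open>('g \<times> 'a) list\<close> is large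
  enough: an irreducible moduloid is generated additively by the products of one of its
  elements, so it has an isomorphic copy over that type. The lemma
  \<open>anneid_radical_annihilates\<close> below confirms that the radical defined here annihilates
  irreducible regular moduloids of every type.
\<close>

definition anneid_radical ::
    "'a homogroupoid \<Rightarrow> 'g homogroupoid \<Rightarrow> ('a \<Rightarrow> 'g \<Rightarrow> 'a \<Rightarrow> 'a) \<Rightarrow> 'a set" where
  "anneid_radical A G mul =
     {a \<in> carrier A. \<forall>(M :: ('g \<times> 'a) list homogroupoid) act.
        irreducible_right_moduloid A G mul M act \<and> regular_right_moduloid A G mul M act
          \<longrightarrow> a \<in> moduloid_annihilator A G M act}"

definition degree_product ::
    "'a homogroupoid \<Rightarrow> ('a \<Rightarrow> 'g \<Rightarrow> 'a \<Rightarrow> 'a) \<Rightarrow> 'a set \<Rightarrow> 'g set \<Rightarrow> 'a set \<Rightarrow> 'a set" where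
  "degree_product A mul \<xi> d \<eta> =
     (if products mul \<xi> d \<eta> \<noteq> {hzero A}
      then THE \<zeta>. \<zeta> \<in> degrees A \<and> products mul \<xi> d \<eta> \<subseteq> \<zeta>
      else {hzero A})"

definition alpha_idempotent ::
    "'a homogroupoid \<Rightarrow> 'g homogroupoid \<Rightarrow> ('a \<Rightarrow> 'g \<Rightarrow> 'a \<Rightarrow> 'a) \<Rightarrow> 'g \<Rightarrow> 'a set \<Rightarrow> bool" where
  "alpha_idempotent A G mul \<alpha> e \<longleftrightarrow>
     e \<in> degrees A \<and> degree_product A mul e (degree G \<alpha>) e = e"


section \<open>Gamma-rings\<close>

text \<open>The abelian groups are written multiplicatively, as in HOL-Algebra's \<open>comm_group\<close>.\<close>

locale gamma_ring =
  R: comm_group R + \<Gamma>: comm_group \<Gamma>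
  for R :: "'a monoid" and \<Gamma> :: "'g monoid" and mul :: "'a \<Rightarrow> 'g \<Rightarrow> 'a \<Rightarrow> 'a" +
  assumes mul_closed: "\<lbrakk>x \<in> carrier R; \<alpha> \<in> carrier \<Gamma>; y \<in> carrier R\<rbrakk> \<Longrightarrow> mul x \<alpha> y \<in> carrier R"
    and mul_left: "\<lbrakk>x \<in> carrier R; x' \<in> carrier R; \<alpha> \<in> carrier \<Gamma>; y \<in> carrier R\<rbrakk>
        \<Longrightarrow> mul (x \<otimes>\<^bsub>R\<^esub> x') \<alpha> y = mul x \<alpha> y \<otimes>\<^bsub>R\<^esub> mul x' \<alpha> y"
    and mul_mid: "\<lbrakk>x \<in> carrier R; \<alpha> \<in> carrier \<Gamma>; \<alpha>' \<in> carrier \<Gamma>; y \<in> carrier R\<rbrakk>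
        \<Longrightarrow> mul x (\<alpha> \<otimes>\<^bsub>\<Gamma>\<^esub> \<alpha>') y = mul x \<alpha> y \<otimes>\<^bsub>R\<^esub> mul x \<alpha>' y"
    and mul_right: "\<lbrakk>x \<in> carrier R; \<alpha> \<in> carrier \<Gamma>; y \<in> carrier R; y' \<in> carrier R\<rbrakk>
        \<Longrightarrow> mul x \<alpha> (y \<otimes>\<^bsub>R\<^esub> y') = mul x \<alpha> y \<otimes>\<^bsub>R\<^esub> mul x \<alpha> y'"
    and mul_assoc: "\<lbrakk>x \<in> carrier R; \<alpha> \<in> carrier \<Gamma>; y \<in> carrier R; \<beta> \<in> carrier \<Gamma>; z \<in> carrier R\<rbrakk>
        \<Longrightarrow> mul (mul x \<alpha> y) \<beta> z = mul x \<alpha> (mul y \<beta> z)"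

locale gamma_module =
  gamma_ring R \<Gamma> mul + V: comm_group V
  for R :: "'a monoid" and \<Gamma> :: "'g monoid" and mul :: "'a \<Rightarrow> 'g \<Rightarrow> 'a \<Rightarrow> 'a"
    and V :: "'v monoid" and act :: "'v \<Rightarrow> 'g \<Rightarrow> 'a \<Rightarrow> 'v" +
  assumes act_closed: "\<lbrakk>v \<in> carrier V; \<alpha> \<in> carrier \<Gamma>; x \<in> carrier R\<rbrakk> \<Longrightarrow> act v \<alpha> x \<in> carrier V"
    and act_left: "\<lbrakk>v \<in> carrier V; v' \<in> carrier V; \<alpha> \<in> carrier \<Gamma>; x \<in> carrier R\<rbrakk>
        \<Longrightarrow> act (v \<otimes>\<^bsub>V\<^esub> v') \<alpha> x = act v \<alpha> x \<otimes>\<^bsub>V\<^esub> act v' \<alpha> x"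
    and act_mid: "\<lbrakk>v \<in> carrier V; \<alpha> \<in> carrier \<Gamma>; \<alpha>' \<in> carrier \<Gamma>; x \<in> carrier R\<rbrakk>
        \<Longrightarrow> act v (\<alpha> \<otimes>\<^bsub>\<Gamma>\<^esub> \<alpha>') x = act v \<alpha> x \<otimes>\<^bsub>V\<^esub> act v \<alpha>' x"
    and act_right: "\<lbrakk>v \<in> carrier V; \<alpha> \<in> carrier \<Gamma>; x \<in> carrier R; x' \<in> carrier R\<rbrakk>
        \<Longrightarrow> act v \<alpha> (x \<otimes>\<^bsub>R\<^esub> x') = act v \<alpha> x \<otimes>\<^bsub>V\<^esub> act v \<alpha> x'"
    and act_assoc: "\<lbrakk>v \<in> carrier V; \<alpha> \<in> carrier \<Gamma>; x \<in> carrier R; \<beta> \<in> carrier \<Gamma>; y \<in> carrier R\<rbrakk>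
        \<Longrightarrow> act (act v \<alpha> x) \<beta> y = act v \<alpha> (mul x \<beta> y)"

definition gamma_submodule ::
    "'a monoid \<Rightarrow> 'g monoid \<Rightarrow> 'v monoid \<Rightarrow> ('v \<Rightarrow> 'g \<Rightarrow> 'a \<Rightarrow> 'v) \<Rightarrow> 'v set \<Rightarrow> bool" where
  "gamma_submodule R \<Gamma> V act N \<longleftrightarrow>
     subgroup N V \<and> (\<forall>v\<in>N. \<forall>\<alpha>\<in>carrier \<Gamma>. \<forall>x\<in>carrier R. act v \<alpha> x \<in> N)"

locale irreducible_gamma_module = gamma_module +
  assumes nontrivial_action: "products act (carrier V) (carrier \<Gamma>) (carrier R) \<noteq> {\<one>\<^bsub>V\<^esub>}"
    and irreducible: "gamma_submodule R \<Gamma> V act N \<Longrightarrow> N = {\<one>\<^bsub>V\<^esub>} \<or> N = carrier V"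

definition gamma_annihilator ::
    "'a monoid \<Rightarrow> 'g monoid \<Rightarrow> 'v monoid \<Rightarrow> ('v \<Rightarrow> 'g \<Rightarrow> 'a \<Rightarrow> 'v) \<Rightarrow> 'a set" where
  "gamma_annihilator R \<Gamma> V act =
     {a \<in> carrier R. products act (carrier V) (carrier \<Gamma>) {a} = {\<one>\<^bsub>V\<^esub>}}"

text \<open>
  The type of the modules is chosen as for \<open>anneid_radical\<close>; see the lemma
  \<open>gamma_radical_annihilates\<close> below.
\<close>

definition gamma_radical ::
    "'a monoid \<Rightarrow> 'g monoid \<Rightarrow> ('a \<Rightarrow> 'g \<Rightarrow> 'a \<Rightarrow> 'a) \<Rightarrow> 'a set" where
  "gamma_radical R \<Gamma> mul =
     {a \<in> carrier R. \<forall>(V :: ('g \<times> 'a) list monoid) act.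
        irreducible_gamma_module R \<Gamma> mul V act \<longrightarrow> a \<in> gamma_annihilator R \<Gamma> V act}"



section \<open>Well-definedness of the above notions\<close>

context homogroupoid
begin

lemma addible_setD: "x \<in> addible_set H a \<Longrightarrow> x \<in> carrier H \<and> a \<sharp> x"
  by (simp add: addible_set_def)

lemma addible_set_addable:
  assumes "a \<in> carrier H" "a \<noteq> hzero H" "x \<in> addible_set H a" "y \<in> addible_set H a"
  shows "x \<sharp> y"
  using assms addable_trans[of x a y] addable_sym[of a x] by (simp add: addible_set_def)

lemma comm_group_addible_set:
  assumes "a \<in> carrier H" "a \<noteq> hzero H"
  shows "comm_group (on_set H (addible_set H a))"
proof -
  interpret g: group "on_set H (addible_set H a)"
    using addibility_group assms .
  show ?thesis
  proof (rule g.group_comm_groupI)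
    fix x y
    assume "x \<in> carrier (on_set H (addible_set H a))" "y \<in> carrier (on_set H (addible_set H a))"
    then have xy: "x \<in> addible_set H a" "y \<in> addible_set H a" by (simp_all add: on_set_def)
    then have "x \<boxplus> y = y \<boxplus> x"
      using add_commute addible_setD addible_set_addable[OF assms] by blast
    then show "x \<otimes>\<^bsub>on_set H (addible_set H a)\<^esub> y = y \<otimes>\<^bsub>on_set H (addible_set H a)\<^esub> x"
      by (simp add: on_set_def)
  qed
qed

lemma comm_group_zero: "comm_group (on_set H {hzero H})"
  by (rule comm_groupI) (auto simp: on_set_def add_zero zero_closed)

lemma zero_addable: "x \<in> carrier H \<Longrightarrow> hzero H \<sharp> x"
  using addable_zero addable_sym zero_closed by blast

lemma zero_add: "x \<in> carrier H \<Longrightarrow> hzero H \<boxplus> x = x"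
  using add_zero add_commute addable_zero zero_closed by metis

lemma idem_zero:
  assumes "x \<in> carrier H" "x \<boxplus> x = x"
  shows "x = hzero H"
proof (rule ccontr)
  assume x: "x \<noteq> hzero H"
  interpret g: comm_group "on_set H (addible_set H x)"
    by (rule comm_group_addible_set) (use assms x in auto)
  have "x \<in> carrier (on_set H (addible_set H x))"
    by (simp add: on_set_def addible_set_def assms addable_refl)
  then have "x = \<one>\<^bsub>on_set H (addible_set H x)\<^esub>"
    using assms(2) g.r_cancel_one' g.r_cancel_one by (simp add: on_set_def)
  then show False using x by (simp add: on_set_def)
qed

lemma hneg_unique:
  assumes "y \<in> carrier H" "z \<in> carrier H" "y \<sharp> z" "y \<boxplus> z = hzero H"
    "z' \<in> carrier H" "y \<sharp> z'" "y \<boxplus> z' = hzero H"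
  shows "z = z'"
proof (cases "y = hzero H")
  case True
  then show ?thesis using assms zero_add by auto
next
  case False
  interpret g: comm_group "on_set H (addible_set H y)"
    by (rule comm_group_addible_set) (use assms False in auto)
  have "y \<in> carrier (on_set H (addible_set H y))" "z \<in> carrier (on_set H (addible_set H y))"
    "z' \<in> carrier (on_set H (addible_set H y))"
    by (simp_all add: on_set_def addible_set_def assms addable_refl)
  moreover have "y \<otimes>\<^bsub>on_set H (addible_set H y)\<^esub> z = y \<otimes>\<^bsub>on_set H (addible_set H y)\<^esub> z'"
    using assms by (simp add: on_set_def)
  ultimately show ?thesis using g.Units_l_cancel g.Units_eq by blast
qed

lemma hneg_ex:
  assumes "y \<in> carrier H"
  shows "\<exists>z. z \<in> carrier H \<and> y \<sharp> z \<and> y \<boxplus> z = hzero H"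
proof (cases "y = hzero H")
  case True
  then show ?thesis using zero_closed addable_zero add_zero by auto
next
  case False
  interpret g: comm_group "on_set H (addible_set H y)"
    by (rule comm_group_addible_set) (use assms False in auto)
  have "y \<in> carrier (on_set H (addible_set H y))"
    by (simp_all add: on_set_def addible_set_def assms addable_refl)
  then have "\<exists>z\<in>carrier (on_set H (addible_set H y)).
      y \<otimes>\<^bsub>on_set H (addible_set H y)\<^esub> z = \<one>\<^bsub>on_set H (addible_set H y)\<^esub>"
    using g.r_inv_ex by blast
  then show ?thesis by (auto simp: on_set_def addible_set_def)
qed

lemma hneg:
  assumes "y \<in> carrier H"
  shows "hneg H y \<in> carrier H" "y \<sharp> hneg H y" "y \<boxplus> hneg H y = hzero H"
proof -
  have "\<exists>!z. z \<in> carrier H \<and> y \<sharp> z \<and> y \<boxplus> z = hzero H"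
    using hneg_ex[OF assms] hneg_unique[OF assms] by blast
  from theI'[OF this] show "hneg H y \<in> carrier H" "y \<sharp> hneg H y" "y \<boxplus> hneg H y = hzero H"
    unfolding hneg_def by auto
qed

lemma hneg_eqI:
  assumes "y \<in> carrier H" "z \<in> carrier H" "y \<sharp> z" "y \<boxplus> z = hzero H"
  shows "hneg H y = z"
  using hneg_unique[OF assms(1)] hneg[OF assms(1)] assms(2-) by blast

lemma hneg_zero: "hneg H (hzero H) = hzero H"
  by (rule hneg_eqI) (auto simp: zero_closed addable_zero add_zero)

lemma addable_add:
  assumes "x \<in> carrier H" "y \<in> carrier H" "z \<in> carrier H" "x \<sharp> y" "x \<sharp> z" "y \<sharp> z"
  shows "x \<sharp> y \<boxplus> z"
proof (cases "x = hzero H")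
  case True
  then show ?thesis using zero_addable add_closed assms by auto
next
  case False
  interpret g: comm_group "on_set H (addible_set H x)"
    by (rule comm_group_addible_set) (use assms False in auto)
  have "y \<otimes>\<^bsub>on_set H (addible_set H x)\<^esub> z \<in> carrier (on_set H (addible_set H x))"
    by (rule g.m_closed) (simp_all add: on_set_def addible_set_def assms)
  then show ?thesis by (simp add: on_set_def addible_set_def)
qed

lemma addable_hneg:
  assumes "x \<in> carrier H" "y \<in> carrier H" "x \<sharp> y"
  shows "x \<sharp> hneg H y"
proof (cases "y = hzero H")
  case True
  then show ?thesis using hneg_zero addable_zero assms by auto
next
  case False
  then show ?thesis using addable_trans[of x y "hneg H y"] hneg[OF assms(2)] assms by auto
qed

lemma hdiff_add:
  assumes "x \<in> carrier H" "s \<in> carrier H" "t \<in> carrier H" "x \<sharp> s" "x \<sharp> t" "s \<sharp> t"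
    and nz: "s \<boxplus> t \<noteq> hzero H"
  shows "hdiff H x s \<sharp> hneg H t" "hdiff H x (s \<boxplus> t) = hdiff H x s \<boxplus> hneg H t"
proof -
  define a where "a = s \<boxplus> t"
  have a: "a \<in> carrier H" using assms add_closed a_def by auto
  have xa: "x \<sharp> a" using assms addable_add a_def by auto
  have sa: "s \<sharp> a" using assms addable_add addable_refl a_def by auto
  have ta: "t \<sharp> a" using assms addable_add addable_refl addable_sym a_def by auto
  define K where "K = on_set H (addible_set H a)"
  interpret g: comm_group K
    unfolding K_def by (rule comm_group_addible_set) (use a nz a_def in auto)
  have mem: "u \<in> carrier K \<longleftrightarrow> u \<in> carrier H \<and> a \<sharp> u" for u
    by (auto simp: K_def on_set_def addible_set_def)
  have opK: "u \<otimes>\<^bsub>K\<^esub> v = u \<boxplus> v" "\<one>\<^bsub>K\<^esub> = hzero H" for u v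
    by (auto simp: K_def on_set_def)
  have neg: "inv\<^bsub>K\<^esub> u = hneg H u \<and> hneg H u \<in> carrier K" if "u \<in> carrier K" for u
  proof -
    have 1: "hneg H u \<in> carrier K"
      using that addable_hneg[of a u] a hneg[of u] by (auto simp: mem)
    have "u \<otimes>\<^bsub>K\<^esub> hneg H u = \<one>\<^bsub>K\<^esub>"
      using that hneg[of u] by (auto simp: mem opK)
    then show ?thesis using 1 that g.inv_equality g.m_comm by metis
  qed
  have m: "x \<in> carrier K" "s \<in> carrier K" "t \<in> carrier K"
    using assms a xa sa ta addable_sym by (auto simp: mem)
  have "x \<otimes>\<^bsub>K\<^esub> inv\<^bsub>K\<^esub> s \<in> carrier K" "inv\<^bsub>K\<^esub> t \<in> carrier K" using m by auto
  then have "x \<boxplus> hneg H s \<in> addible_set H a" "hneg H t \<in> addible_set H a"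
    using neg m by (auto simp: opK K_def on_set_def)
  then show "hdiff H x s \<sharp> hneg H t"
    unfolding hdiff_def using addible_set_addable[of a] a nz a_def by blast
  have "x \<otimes>\<^bsub>K\<^esub> inv\<^bsub>K\<^esub> (s \<otimes>\<^bsub>K\<^esub> t) = (x \<otimes>\<^bsub>K\<^esub> inv\<^bsub>K\<^esub> s) \<otimes>\<^bsub>K\<^esub> inv\<^bsub>K\<^esub> t"
    using m by (simp add: g.inv_mult g.m_assoc)
  moreover have "s \<otimes>\<^bsub>K\<^esub> t \<in> carrier K" using m by auto
  ultimately show "hdiff H x (s \<boxplus> t) = hdiff H x s \<boxplus> hneg H t"
    using neg m unfolding hdiff_def by (simp add: opK)
qed

lemma degrees_addable:
  assumes "\<xi> \<in> degrees H" "x \<in> \<xi>" "y \<in> \<xi>"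
  shows "x \<in> carrier H" "y \<in> carrier H" "x \<sharp> y"
  using assms addible_set_addable zero_closed addable_zero
  by (auto simp: degrees_def addible_set_def)

lemma comm_group_degrees: "\<xi> \<in> degrees H \<Longrightarrow> comm_group (on_set H \<xi>)"
  using comm_group_zero comm_group_addible_set by (auto simp: degrees_def)

lemma degree_in_degrees: "a \<in> carrier H \<Longrightarrow> degree H a \<in> degrees H"
  by (auto simp: degrees_def degree_def)

lemma degrees_eq_addible_set:
  assumes "\<zeta> \<in> degrees H" "u \<in> \<zeta>" "u \<noteq> hzero H"
  shows "\<zeta> = addible_set H u"
proof -
  obtain c where c: "\<zeta> = addible_set H c" "c \<in> carrier H" "c \<noteq> hzero H"
    using assms by (auto simp: degrees_def)
  have u: "u \<in> carrier H" "c \<sharp> u" using assms c by (auto simp: addible_set_def)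
  have "c \<sharp> x \<longleftrightarrow> u \<sharp> x" if "x \<in> carrier H" for x
    using addable_trans[OF c(2) u(1) that u(2) _ assms(3)]
      addable_trans[OF u(1) c(2) that addable_sym[OF c(2) u] _ c(3)] by blast
  then show ?thesis using c by (auto simp: addible_set_def)
qed

lemma transport:
  assumes fg: "\<And>m. m \<in> carrier H \<Longrightarrow> f (g m) = m"
  defines "H' \<equiv> \<lparr>carrier = g ` carrier H, addable = (\<lambda>k l. f k \<sharp> f l),
                 hadd = (\<lambda>k l. g (f k \<boxplus> f l)), hzero = g (hzero H)\<rparr>"
  shows "homogroupoid H'"
proof (rule homogroupoid.intro)
  fix a' assume "a' \<in> carrier H'" and a'0: "a' \<noteq> hzero H'"
  then obtain a where a: "a \<in> carrier H" "a' = g a" by (auto simp: H'_def)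
  have a0: "a \<noteq> hzero H" using a a'0 by (auto simp: H'_def)
  interpret K: comm_group "on_set H (addible_set H a)"
    using a(1) a0 by (rule comm_group_addible_set)
  have inj: "inj_on g (carrier H)" by (metis fg inj_onI)
  have im: "addible_set H' a' = g ` addible_set H a"
    using a fg by (auto simp: addible_set_def H'_def)
  let ?K' = "on_set H' (addible_set H' a')"
  have fgK: "f (g x) = x" if "x \<in> addible_set H a" for x
    using that fg by (simp add: addible_set_def)
  have "group ?K'"
  proof (rule groupI)
    show "\<one>\<^bsub>?K'\<^esub> \<in> carrier ?K'"
      using K.one_closed by (simp add: on_set_def im) (simp add: H'_def)
    show "x \<otimes>\<^bsub>?K'\<^esub> y \<in> carrier ?K'" if "x \<in> carrier ?K'" "y \<in> carrier ?K'" for x y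
    proof -
      obtain u v where "u \<in> addible_set H a" "v \<in> addible_set H a" "x = g u" "y = g v"
        using \<open>x \<in> carrier ?K'\<close> \<open>y \<in> carrier ?K'\<close> by (auto simp: on_set_def im)
      then show ?thesis using K.m_closed[of u v] fgK by (auto simp: on_set_def im) (simp add: H'_def)
    qed
    show "x \<otimes>\<^bsub>?K'\<^esub> y \<otimes>\<^bsub>?K'\<^esub> z = x \<otimes>\<^bsub>?K'\<^esub> (y \<otimes>\<^bsub>?K'\<^esub> z)"
      if xyz: "x \<in> carrier ?K'" "y \<in> carrier ?K'" "z \<in> carrier ?K'" for x y z
    proof -
      obtain u v w where *: "u \<in> addible_set H a" "v \<in> addible_set H a" "w \<in> addible_set H a"
        "x = g u" "y = g v" "z = g w"
        using xyz by (auto simp: on_set_def im)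
      then have "u \<boxplus> v \<in> addible_set H a" "v \<boxplus> w \<in> addible_set H a"
        using K.m_closed by (auto simp: on_set_def)
      then show ?thesis using K.m_assoc[of u v w] fgK * by (auto simp: on_set_def H'_def)
    qed
    show "\<one>\<^bsub>?K'\<^esub> \<otimes>\<^bsub>?K'\<^esub> x = x" if x: "x \<in> carrier ?K'" for x
    proof -
      obtain u where *: "u \<in> addible_set H a" "x = g u"
        using x by (auto simp: on_set_def im)
      then show ?thesis using K.l_one[of u] fgK fg[OF zero_closed] by (auto simp: on_set_def H'_def)
    qed
    show "\<exists>y\<in>carrier ?K'. y \<otimes>\<^bsub>?K'\<^esub> x = \<one>\<^bsub>?K'\<^esub>" if x: "x \<in> carrier ?K'" for x
    proof -
      obtain u where *: "u \<in> addible_set H a" "x = g u"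
        using x by (auto simp: on_set_def im)
      obtain v where v: "v \<in> addible_set H a" "v \<boxplus> u = hzero H"
        using K.l_inv_ex[of u] * by (auto simp: on_set_def)
      have "g v \<in> carrier ?K'" using v by (simp add: on_set_def im)
      moreover have "g v \<otimes>\<^bsub>?K'\<^esub> x = \<one>\<^bsub>?K'\<^esub>"
        using v * fgK by (simp add: on_set_def H'_def)
      ultimately show ?thesis by blast
    qed
  qed
  then show "group (on_set H' (addible_set H' a'))" .
next
  fix x y z
  assume xyz: "x \<in> carrier H'" "y \<in> carrier H'" "z \<in> carrier H'"
    and *: "x \<sharp>\<^bsub>H'\<^esub> y" "y \<sharp>\<^bsub>H'\<^esub> z" "y \<noteq> hzero H'"
  obtain u v w where uvw: "u \<in> carrier H" "v \<in> carrier H" "w \<in> carrier H"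
    "x = g u" "y = g v" "z = g w"
    using xyz by (auto simp: H'_def)
  then have "u \<sharp> v" "v \<sharp> w" "v \<noteq> hzero H" using * by (auto simp: H'_def fg)
  then show "x \<sharp>\<^bsub>H'\<^esub> z" using addable_trans[of u v w] uvw by (simp add: H'_def fg)
qed (auto simp: H'_def fg zero_closed add_closed addable_refl addable_zero add_zero
       intro: addable_sym intro!: arg_cong[where f = g] add_commute)

end

context anneid
begin

lemma products_addable2:
  assumes "a \<in> carrier A" "a' \<in> carrier A" "a \<sharp>\<^bsub>A\<^esub> a'"
    "\<gamma> \<in> carrier G" "\<gamma>' \<in> carrier G" "\<gamma> \<sharp>\<^bsub>G\<^esub> \<gamma>'" "b \<in> carrier A"
  shows "mul a \<gamma> b \<sharp>\<^bsub>A\<^esub> mul a' \<gamma>' b"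
proof -
  have c: "mul a \<gamma> b \<in> carrier A" "mul a' \<gamma> b \<in> carrier A" "mul a \<gamma>' b \<in> carrier A"
    "mul a' \<gamma>' b \<in> carrier A" using assms mul_closed by auto
  consider "mul a' \<gamma> b \<noteq> hzero A" | "mul a \<gamma>' b \<noteq> hzero A"
    | "mul a' \<gamma> b = hzero A" "mul a \<gamma>' b = hzero A" by blast
  then show ?thesis
  proof cases
    case 1
    then show ?thesis
      using A.addable_trans[OF c(1,2,4)] mul_left[of a a' \<gamma> b] mul_mid[of a' \<gamma> \<gamma>' b] assms by auto
  next
    case 2
    then show ?thesis
      using A.addable_trans[OF c(1,3,4)] mul_left[of a a' \<gamma>' b] mul_mid[of a \<gamma> \<gamma>' b] assms by auto
  next
    case 3
    have "mul (a \<boxplus>\<^bsub>A\<^esub> a') \<gamma> b \<sharp>\<^bsub>A\<^esub> mul (a \<boxplus>\<^bsub>A\<^esub> a') \<gamma>' b"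
      using assms A.add_closed mul_mid by auto
    then show ?thesis
      using 3 c assms mul_left[of a a' \<gamma> b] mul_left[of a a' \<gamma>' b] A.add_zero A.zero_add by auto
  qed
qed

lemma products_addable:
  assumes "a \<in> carrier A" "a' \<in> carrier A" "a \<sharp>\<^bsub>A\<^esub> a'"
    "\<gamma> \<in> carrier G" "\<gamma>' \<in> carrier G" "\<gamma> \<sharp>\<^bsub>G\<^esub> \<gamma>'"
    "b \<in> carrier A" "b' \<in> carrier A" "b \<sharp>\<^bsub>A\<^esub> b'"
  shows "mul a \<gamma> b \<sharp>\<^bsub>A\<^esub> mul a' \<gamma>' b'"
proof -
  have c: "mul a \<gamma> b \<in> carrier A" "mul a' \<gamma>' b \<in> carrier A" "mul a \<gamma> b' \<in> carrier A"
    "mul a' \<gamma>' b' \<in> carrier A" using assms mul_closed by auto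
  consider "mul a' \<gamma>' b \<noteq> hzero A" | "mul a \<gamma> b' \<noteq> hzero A"
    | "mul a' \<gamma>' b = hzero A" "mul a \<gamma> b' = hzero A" by blast
  then show ?thesis
  proof cases
    case 1
    then show ?thesis
      using A.addable_trans[OF c(1,2,4)] products_addable2[of a a' \<gamma> \<gamma>' b]
        mul_right[of a' \<gamma>' b b'] assms by auto
  next
    case 2
    then show ?thesis
      using A.addable_trans[OF c(1,3,4)] products_addable2[of a a' \<gamma> \<gamma>' b']
        mul_right[of a \<gamma> b b'] assms by auto
  next
    case 3
    have "mul a \<gamma> (b \<boxplus>\<^bsub>A\<^esub> b') \<sharp>\<^bsub>A\<^esub> mul a' \<gamma>' (b \<boxplus>\<^bsub>A\<^esub> b')"
      using assms A.add_closed products_addable2 by auto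
    then show ?thesis
      using 3 c assms mul_right[of a \<gamma> b b'] mul_right[of a' \<gamma>' b b'] A.add_zero A.zero_add by auto
  qed
qed

lemma degree_product_ex1:
  assumes "\<xi> \<in> degrees A" "d \<in> degrees G" "\<eta> \<in> degrees A" "\<xi> \<noteq> {}" "d \<noteq> {}" "\<eta> \<noteq> {}"
    and nz: "products mul \<xi> d \<eta> \<noteq> {hzero A}"
  shows "\<exists>!\<zeta>. \<zeta> \<in> degrees A \<and> products mul \<xi> d \<eta> \<subseteq> \<zeta>"
proof -
  have sub: "products mul \<xi> d \<eta> \<subseteq> carrier A"
    using A.degrees_addable(1)[OF assms(1)] G.degrees_addable(1)[OF assms(2)]
      A.degrees_addable(1)[OF assms(3)] by (auto simp: products_def intro!: mul_closed)
  have add: "x \<sharp>\<^bsub>A\<^esub> y" if "x \<in> products mul \<xi> d \<eta>" "y \<in> products mul \<xi> d \<eta>" for x y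
    using that A.degrees_addable[OF assms(1)] G.degrees_addable[OF assms(2)]
      A.degrees_addable[OF assms(3)] by (auto simp: products_def intro!: products_addable)
  have "products mul \<xi> d \<eta> \<noteq> {}" using assms(4-6) by (auto simp: products_def)
  then obtain u where u: "u \<in> products mul \<xi> d \<eta>" "u \<noteq> hzero A" using nz by blast
  have uA: "u \<in> carrier A" using u sub by blast
  show ?thesis
  proof (rule ex1I[of _ "addible_set A u"])
    show "addible_set A u \<in> degrees A \<and> products mul \<xi> d \<eta> \<subseteq> addible_set A u"
      using u uA sub add by (auto simp: degrees_def addible_set_def)
    show "\<zeta> = addible_set A u" if "\<zeta> \<in> degrees A \<and> products mul \<xi> d \<eta> \<subseteq> \<zeta>" for \<zeta>
      using that u A.degrees_eq_addible_set by blast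
  qed
qed

lemma component_gamma_ring:
  assumes \<alpha>: "\<alpha> \<in> carrier G" "\<alpha> \<noteq> hzero G" and e: "alpha_idempotent A G mul \<alpha> e"
  shows "gamma_ring (on_set A e) (on_set G (addible_set G \<alpha>)) mul"
proof -
  define d where "d = addible_set G \<alpha>"
  have dd: "d \<in> degrees G" "degree G \<alpha> = d" using \<alpha> by (auto simp: degrees_def degree_def d_def)
  have ed: "e \<in> degrees A" and ee: "degree_product A mul e d e = e"
    using e dd by (auto simp: alpha_idempotent_def)
  interpret R: comm_group "on_set A e" using ed by (rule A.comm_group_degrees)
  interpret D: comm_group "on_set G d" using dd by (auto intro: G.comm_group_degrees)
  have ne: "e \<noteq> {}" "d \<noteq> {}" using R.one_closed D.one_closed by (auto simp: on_set_def)
  have sub: "products mul e d e \<subseteq> e"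
  proof (cases "products mul e d e = {hzero A}")
    case True
    then show ?thesis using R.one_closed by (simp add: on_set_def)
  next
    case False
    have "e = (THE \<zeta>. \<zeta> \<in> degrees A \<and> products mul e d e \<subseteq> \<zeta>)"
      using ee False by (simp add: degree_product_def)
    then show ?thesis
      using theI'[OF degree_product_ex1[OF ed dd(1) ed ne(1,2,1) False]] by simp
  qed
  have "gamma_ring (on_set A e) (on_set G d) mul"
  proof
    show "mul x \<gamma> y \<in> carrier (on_set A e)"
      if "x \<in> carrier (on_set A e)" "\<gamma> \<in> carrier (on_set G d)" "y \<in> carrier (on_set A e)" for x \<gamma> y
      using that sub by (auto simp: on_set_def products_def)
  qed (use A.degrees_addable[OF ed] G.degrees_addable[OF dd(1)] mul_left mul_mid mul_right mul_assoc
        in \<open>auto simp: on_set_def\<close>)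
  then show ?thesis by (simp add: d_def)
qed

end

context right_moduloid
begin

lemma act_zero:
  assumes "\<alpha> \<in> carrier G" "a \<in> carrier A"
  shows "act (hzero M) \<alpha> a = hzero M"
  using act_left[of "hzero M" "hzero M" \<alpha> a] M.zero_closed M.addable_zero M.add_zero assms
    M.idem_zero act_closed by metis

lemma act_zero_right:
  assumes "w \<in> carrier M" "\<alpha> \<in> carrier G"
  shows "act w \<alpha> (hzero A) = hzero M"
  using act_right[of w \<alpha> "hzero A" "hzero A"] A.zero_closed A.addable_zero A.add_zero assms
    M.idem_zero act_closed by metis

lemma act_hneg:
  assumes "w \<in> carrier M" "\<alpha> \<in> carrier G" "a \<in> carrier A"
  shows "act w \<alpha> (hneg A a) = hneg M (act w \<alpha> a)"
proof (rule sym, rule M.hneg_eqI)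
  show "act w \<alpha> a \<boxplus>\<^bsub>M\<^esub> act w \<alpha> (hneg A a) = hzero M"
    using act_right[of w \<alpha> a "hneg A a"] A.hneg[OF assms(3)] act_zero_right assms by metis
qed (use assms A.hneg act_closed act_right in auto)

inductive_set span :: "'m \<Rightarrow> 'm set" for v where
  zero: "hzero M \<in> span v"
| add: "\<lbrakk>s \<in> span v; \<gamma> \<in> carrier G; a \<in> carrier A; s \<sharp>\<^bsub>M\<^esub> act v \<gamma> a\<rbrakk>
        \<Longrightarrow> s \<boxplus>\<^bsub>M\<^esub> act v \<gamma> a \<in> span v"

lemma span_closed: "v \<in> carrier M \<Longrightarrow> s \<in> span v \<Longrightarrow> s \<in> carrier M"
  by (rotate_tac, induction rule: span.induct) (auto intro: M.zero_closed M.add_closed act_closed)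

lemma span_act:
  assumes v: "v \<in> carrier M" and "s \<in> span v" "\<delta> \<in> carrier G" "b \<in> carrier A"
  shows "act s \<delta> b \<in> span v"
  using assms(2)
proof induction
  case zero
  then show ?case using act_zero assms span.zero by auto
next
  case (add s \<gamma> a)
  have *: "act s \<delta> b \<sharp>\<^bsub>M\<^esub> act (act v \<gamma> a) \<delta> b"
    "act (s \<boxplus>\<^bsub>M\<^esub> act v \<gamma> a) \<delta> b = act s \<delta> b \<boxplus>\<^bsub>M\<^esub> act (act v \<gamma> a) \<delta> b"
    using act_left[of s "act v \<gamma> a" \<delta> b] add act_closed assms span_closed by auto
  have "act (act v \<gamma> a) \<delta> b = act v \<gamma> (mul a \<delta> b)" using act_assoc assms add by auto
  then show ?case using * span.add[OF add.IH add.hyps(2), of "mul a \<delta> b"] mul_closed assms add by auto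
qed

lemma span_diff:
  assumes v: "v \<in> carrier M" and "y \<in> span v" "x \<in> span v" "x \<sharp>\<^bsub>M\<^esub> y"
  shows "hdiff M x y \<in> span v"
  using assms(2-)
proof (induction arbitrary: x)
  case zero
  then show ?case using span_closed[OF v] M.add_zero M.hneg_zero by (auto simp: hdiff_def)
next
  case (add s \<gamma> a)
  let ?t = "act v \<gamma> a"
  have c: "x \<in> carrier M" "s \<in> carrier M" "?t \<in> carrier M"
    using span_closed[OF v] add act_closed v by auto
  show ?case
  proof (cases "s \<boxplus>\<^bsub>M\<^esub> ?t = hzero M")
    case True
    then show ?thesis using add.prems c M.add_zero M.hneg_zero by (simp add: hdiff_def)
  next
    case False
    have yc: "s \<boxplus>\<^bsub>M\<^esub> ?t \<in> carrier M" using c add M.add_closed by auto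
    have sy: "s \<sharp>\<^bsub>M\<^esub> s \<boxplus>\<^bsub>M\<^esub> ?t" using c add M.addable_add M.addable_refl by auto
    have ty: "?t \<sharp>\<^bsub>M\<^esub> s \<boxplus>\<^bsub>M\<^esub> ?t" using c add M.addable_add M.addable_refl M.addable_sym by auto
    have xs: "x \<sharp>\<^bsub>M\<^esub> s" "x \<sharp>\<^bsub>M\<^esub> ?t"
      using M.addable_trans[OF c(1) yc c(2)] M.addable_trans[OF c(1) yc c(3)] False add.prems
        M.addable_sym[OF c(2) yc sy] M.addable_sym[OF c(3) yc ty] by auto
    have "hdiff M x s \<in> span v" using add xs by auto
    moreover have "hneg M ?t = act v \<gamma> (hneg A a)" using act_hneg add v by auto
    ultimately show ?thesis
      using M.hdiff_add[OF c xs add.hyps(4) False] span.add[OF _ add.hyps(2), of "hdiff M x s"]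
        A.hneg add.hyps by auto
  qed
qed

end

lemma anneid_radical_annihilates:
  fixes M :: "'m homogroupoid" and A :: "'a homogroupoid" and G :: "'g homogroupoid"
  assumes x: "x \<in> anneid_radical A G mul"
    and irr: "irreducible_right_moduloid A G mul M act"
    and reg: "regular_right_moduloid A G mul M act"
  shows "x \<in> moduloid_annihilator A G M act"
proof -
  interpret irreducible_right_moduloid A G mul M act by (rule irr)
  interpret r: regular_right_moduloid A G mul M act by (rule reg)
  have "products act (carrier M) (carrier G) (carrier A) \<noteq> {}"
    using M.zero_closed G.zero_closed A.zero_closed by (auto simp: products_def)
  then obtain u where "u \<in> products act (carrier M) (carrier G) (carrier A)" "u \<noteq> hzero M"
    using nontrivial_action by blast
  then obtain v \<gamma>0 a0 where v: "v \<in> carrier M" and 0: "\<gamma>0 \<in> carrier G" "a0 \<in> carrier A"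
    "act v \<gamma>0 a0 \<noteq> hzero M"
    by (auto simp: products_def)
  have "submoduloid A G M act (span v)"
    unfolding submoduloid_def
    using span.zero[of v] span_closed[OF v] span_diff[OF v] span_act[OF v] by auto
  moreover have "act v \<gamma>0 a0 \<in> span v"
    using span.add[OF span.zero 0(1,2), of v] M.zero_addable M.zero_add act_closed[OF v 0(1,2)] by auto
  ultimately have all: "span v = carrier M" using irreducible 0 by blast
  define f where "f = foldr (\<lambda>(\<gamma>, a) s. s \<boxplus>\<^bsub>M\<^esub> act v \<gamma> a)"
  define F where "F l = f l (hzero M)" for l
  have "s \<in> range F" if "s \<in> span v" for s
    using that
  proof induction
    case zero
    show ?case by (rule range_eqI[of _ _ "[]"]) (simp add: F_def f_def)
  next
    case (add s \<gamma> a)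
    then obtain l where "s = F l" by auto
    then show ?case by (intro range_eqI[of _ _ "(\<gamma>, a) # l"]) (simp add: F_def f_def)
  qed
  then have FG: "F (inv_into UNIV F m) = m" if "m \<in> carrier M" for m
    using that all by (auto intro: f_inv_into_f)
  define g where "g = inv_into UNIV F"
  have fg: "F (g m) = m" if "m \<in> carrier M" for m using FG that by (simp add: g_def)
  define M' where "M' = \<lparr>carrier = g ` carrier M, addable = (\<lambda>k l. F k \<sharp>\<^bsub>M\<^esub> F l),
                 hadd = (\<lambda>k l. g (F k \<boxplus>\<^bsub>M\<^esub> F l)), hzero = g (hzero M)\<rparr>"
  define act' where "act' k \<gamma> a = g (act (F k) \<gamma> a)" for k \<gamma> a
  interpret M': homogroupoid M'
    unfolding M'_def by (rule M.transport) (rule fg)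
  interpret M': right_moduloid A G mul M' act'
    by unfold_locales
      (auto simp: M'_def act'_def fg act_closed act_right act_left act_assoc M.add_closed)
  have ginj: "g m = g n \<longleftrightarrow> m = n" if "m \<in> carrier M" "n \<in> carrier M" for m n
    using fg that by metis
  have prod: "products act' (carrier M') (carrier G) X = g ` products act (carrier M) (carrier G) X"
    if "X \<subseteq> carrier A" for X
    using that by (force simp: products_def M'_def act'_def fg act_closed image_iff)
  have prod_sub: "products act (carrier M) (carrier G) X \<subseteq> carrier M" if "X \<subseteq> carrier A" for X
    using that by (auto simp: products_def act_closed)
  have prod_zero: "products act' (carrier M') (carrier G) X = {hzero M'} \<longleftrightarrow>
     products act (carrier M) (carrier G) X = {hzero M}" if "X \<subseteq> carrier A" for X
  proof -
    have inj: "inj_on g (carrier M)" by (metis fg inj_onI)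
    have "g ` P = g ` {hzero M} \<longleftrightarrow> P = {hzero M}" if "P \<subseteq> carrier M" for P
      by (rule inj_on_image_eq_iff[OF inj that]) (simp add: M.zero_closed)
    then show ?thesis using prod[OF that] prod_sub[OF that] by (simp add: M'_def)
  qed
  have neg': "hneg M' (g m) = g (hneg M m)" if "m \<in> carrier M" for m
    by (rule M'.hneg_eqI) (use that M.hneg in \<open>auto simp: M'_def fg\<close>)
  have "irreducible_right_moduloid A G mul M' act'"
  proof
    show "products act' (carrier M') (carrier G) (carrier A) \<noteq> {hzero M'}"
      using nontrivial_action prod_zero by auto
  next
    fix N' assume N': "submoduloid A G M' act' N'"
    define N where "N = F ` N'"
    have sub: "N' \<subseteq> g ` carrier M" using N' by (auto simp: submoduloid_def M'_def)
    then have gF: "g (F k) = k \<and> F k \<in> carrier M" if "k \<in> N'" for k using that fg by auto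
    then have NN: "N' = g ` N" by (force simp: N_def image_iff)
    have "submoduloid A G M act N"
      unfolding submoduloid_def
    proof (intro conjI ballI impI)
      show "N \<noteq> {}" using N' by (auto simp: submoduloid_def N_def)
      show "N \<subseteq> carrier M" using gF by (auto simp: N_def)
    next
      fix p q assume "p \<in> N" "q \<in> N" "p \<sharp>\<^bsub>M\<^esub> q"
      then obtain k l where kl: "k \<in> N'" "l \<in> N'" "p = F k" "q = F l" by (auto simp: N_def)
      have pq: "p \<in> carrier M" "q \<in> carrier M" using kl gF by auto
      have "k \<sharp>\<^bsub>M'\<^esub> l" using kl \<open>p \<sharp>\<^bsub>M\<^esub> q\<close> by (simp add: M'_def)
      then have "hdiff M' k l \<in> N'" using N' kl by (auto simp: submoduloid_def)
      moreover have "hneg M' l = g (hneg M q)" using neg' pq kl gF by metis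
      then have "hdiff M' k l = g (hdiff M p q)"
        using kl pq M.hneg fg by (auto simp: hdiff_def M'_def)
      moreover have "hdiff M p q \<in> carrier M"
        unfolding hdiff_def using pq M.hneg M.add_closed M.addable_hneg \<open>p \<sharp>\<^bsub>M\<^esub> q\<close> by auto
      ultimately show "hdiff M p q \<in> N" using fg by (metis N_def image_eqI)
    next
      fix p \<alpha> a assume "p \<in> N" and \<alpha>a: "\<alpha> \<in> carrier G" "a \<in> carrier A"
      then obtain k where k: "k \<in> N'" "p = F k" by (auto simp: N_def)
      then have "g (act p \<alpha> a) \<in> N'" using N' \<alpha>a by (auto simp: submoduloid_def act'_def)
      moreover have "act p \<alpha> a \<in> carrier M" using k gF \<alpha>a act_closed by auto
      ultimately show "act p \<alpha> a \<in> N" using fg by (metis N_def image_eqI)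
    qed
    then have "N = {hzero M} \<or> N = carrier M" by (rule irreducible)
    then show "N' = {hzero M'} \<or> N' = carrier M'" using NN by (auto simp: M'_def)
  qed
  moreover have "regular_right_moduloid A G mul M' act'"
  proof (unfold_locales, goal_cases)
    case (1 k \<alpha> \<beta> a b)
    then obtain p where "p \<in> carrier M" "k = g p" by (auto simp: M'_def)
    then show ?case
      using 1 r.regular[of p \<alpha> \<beta> a b] act_closed by (auto simp: M'_def act'_def fg ginj M.zero_closed)
  qed
  ultimately have "x \<in> moduloid_annihilator A G M' act'"
    using x by (auto simp: anneid_radical_def)
  then show ?thesis using prod_zero[of "{x}"] by (simp add: moduloid_annihilator_def)
qed

lemma gamma_radical_annihilates:
  fixes V :: "'v monoid" and R :: "'a monoid" and \<Gamma> :: "'g monoid"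
  assumes x: "x \<in> gamma_radical R \<Gamma> mul"
    and irr: "irreducible_gamma_module R \<Gamma> mul V act"
  shows "x \<in> gamma_annihilator R \<Gamma> V act"
proof -
  interpret irreducible_gamma_module R \<Gamma> mul V act by (rule irr)
  have "products act (carrier V) (carrier \<Gamma>) (carrier R) \<noteq> {}"
    using V.one_closed \<Gamma>.one_closed R.one_closed unfolding products_def by blast
  then obtain u where "u \<in> products act (carrier V) (carrier \<Gamma>) (carrier R)" "u \<noteq> \<one>\<^bsub>V\<^esub>"
    using nontrivial_action by blast
  then obtain v \<gamma>0 a0 where v: "v \<in> carrier V" and 0: "\<gamma>0 \<in> carrier \<Gamma>" "a0 \<in> carrier R"
    "act v \<gamma>0 a0 \<noteq> \<one>\<^bsub>V\<^esub>"
    by (auto simp: products_def)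
  have act_one: "act \<one>\<^bsub>V\<^esub> \<gamma> a = \<one>\<^bsub>V\<^esub>" if "\<gamma> \<in> carrier \<Gamma>" "a \<in> carrier R" for \<gamma> a
    using act_left[of "\<one>\<^bsub>V\<^esub>" "\<one>\<^bsub>V\<^esub>" \<gamma> a] act_closed[of "\<one>\<^bsub>V\<^esub>" \<gamma> a] that by simp
  have act_inv: "act w \<gamma> (inv\<^bsub>R\<^esub> a) = inv\<^bsub>V\<^esub> (act w \<gamma> a)"
    if "w \<in> carrier V" "\<gamma> \<in> carrier \<Gamma>" "a \<in> carrier R" for w \<gamma> a
  proof -
    have "act w \<gamma> \<one>\<^bsub>R\<^esub> = \<one>\<^bsub>V\<^esub>"
      using act_right[of w \<gamma> "\<one>\<^bsub>R\<^esub>" "\<one>\<^bsub>R\<^esub>"] act_closed[of w \<gamma> "\<one>\<^bsub>R\<^esub>"] that by simp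
    then have "act w \<gamma> a \<otimes>\<^bsub>V\<^esub> act w \<gamma> (inv\<^bsub>R\<^esub> a) = \<one>\<^bsub>V\<^esub>"
      using act_right[of w \<gamma> a "inv\<^bsub>R\<^esub> a"] that by simp
    then show ?thesis using V.inv_equality V.m_comm that act_closed R.inv_closed by metis
  qed
  define F where "F l = foldr (\<lambda>(\<gamma>, a) s. s \<otimes>\<^bsub>V\<^esub> act v \<gamma> a) l \<one>\<^bsub>V\<^esub>" for l
  have F: "F [] = \<one>\<^bsub>V\<^esub>" "F ((\<gamma>, a) # l) = F l \<otimes>\<^bsub>V\<^esub> act v \<gamma> a" for \<gamma> a l
    by (simp_all add: F_def)
  define L where "L = lists (carrier \<Gamma> \<times> carrier R)"
  have Fc: "F l \<in> carrier V" if "l \<in> L" for l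
    using that unfolding L_def by (induction) (auto simp: F v act_closed)
  have L_Cons: "(\<gamma>, a) # l \<in> L \<longleftrightarrow> \<gamma> \<in> carrier \<Gamma> \<and> a \<in> carrier R \<and> l \<in> L" "[] \<in> L" for \<gamma> a l
    by (auto simp: L_def)
  have Fmul: "F k \<otimes>\<^bsub>V\<^esub> F l \<in> F ` L" if "k \<in> L" "l \<in> L" for k l
  proof -
    have "F (l @ k) = F k \<otimes>\<^bsub>V\<^esub> F l \<and> l @ k \<in> L"
      using that(2)
    proof (induction l)
      case Nil
      then show ?case using that Fc by (simp add: F)
    next
      case (Cons p l)
      obtain \<gamma> a where p: "p = (\<gamma>, a)" by (cases p)
      then show ?case
        using Cons that(1) Fc act_closed v by (simp add: F L_Cons V.m_assoc)
    qed
    then show ?thesis by force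
  qed
  have Finv: "inv\<^bsub>V\<^esub> (F l) \<in> F ` L" if "l \<in> L" for l
    using that
  proof (induction l)
    case Nil
    then show ?case using F(1) L_Cons(2) by (metis V.inv_one image_eqI)
  next
    case (Cons p l)
    obtain \<gamma> a where p: "p = (\<gamma>, a)" by (cases p)
    have m: "\<gamma> \<in> carrier \<Gamma>" "a \<in> carrier R" "l \<in> L" using Cons.prems p L_Cons by auto
    then obtain k where k: "k \<in> L" "inv\<^bsub>V\<^esub> (F l) = F k" using Cons by auto
    have "inv\<^bsub>V\<^esub> (F (p # l)) = F ((\<gamma>, inv\<^bsub>R\<^esub> a) # k)"
      using m p k Fc act_closed v act_inv by (simp add: F V.inv_mult)
    moreover have "(\<gamma>, inv\<^bsub>R\<^esub> a) # k \<in> L" using m k by (simp add: L_Cons)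
    ultimately show ?case by blast
  qed
  have Fact: "act (F l) \<delta> b \<in> F ` L" if "l \<in> L" "\<delta> \<in> carrier \<Gamma>" "b \<in> carrier R" for l \<delta> b
    using that(1)
  proof (induction l)
    case Nil
    then show ?case using F(1) L_Cons(2) act_one that by (metis image_eqI)
  next
    case (Cons p l)
    obtain \<gamma> a where p: "p = (\<gamma>, a)" by (cases p)
    have m: "\<gamma> \<in> carrier \<Gamma>" "a \<in> carrier R" "l \<in> L" using Cons.prems p L_Cons by auto
    then obtain k where k: "k \<in> L" "act (F l) \<delta> b = F k" using Cons by auto
    have "act (F (p # l)) \<delta> b = F ((\<gamma>, mul a \<delta> b) # k)"
      using m p k Fc act_closed v act_left[of "F l" "act v \<gamma> a" \<delta> b] act_assoc that by (simp add: F)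
    moreover have "(\<gamma>, mul a \<delta> b) # k \<in> L" using m k that mul_closed by (simp add: L_Cons)
    ultimately show ?case by blast
  qed
  have "subgroup (F ` L) V"
    by (rule V.subgroupI) (use Fc L_Cons(2) Finv Fmul in auto)
  then have "gamma_submodule R \<Gamma> V act (F ` L)"
    using Fact by (auto simp: gamma_submodule_def)
  moreover have "act v \<gamma>0 a0 \<in> F ` L"
    by (rule image_eqI[of _ _ "[(\<gamma>0, a0)]"]) (auto simp: F L_Cons 0 v act_closed)
  ultimately have all: "F ` L = carrier V" using irreducible 0 by blast
  define g where "g = inv_into UNIV F"
  have fg: "F (g m) = m" if "m \<in> carrier V" for m
    unfolding g_def by (rule f_inv_into_f) (use that all in auto)
  define V' where "V' = \<lparr>carrier = g ` carrier V, mult = (\<lambda>k l. g (F k \<otimes>\<^bsub>V\<^esub> F l)), one = g \<one>\<^bsub>V\<^esub>\<rparr>"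
  define act' where "act' k \<gamma> a = g (act (F k) \<gamma> a)" for k \<gamma> a
  interpret V': comm_group V'
  proof (rule comm_groupI)
    fix x assume "x \<in> carrier V'"
    then obtain u where u: "u \<in> carrier V" "x = g u" by (auto simp: V'_def)
    show "\<exists>y\<in>carrier V'. y \<otimes>\<^bsub>V'\<^esub> x = \<one>\<^bsub>V'\<^esub>"
      by (rule bexI[of _ "g (inv\<^bsub>V\<^esub> u)"]) (use u in \<open>auto simp: V'_def fg\<close>)
  qed (auto simp: V'_def fg V.m_assoc intro!: arg_cong[where f = g] V.m_comm)
  interpret V': gamma_module R \<Gamma> mul V' act'
    by unfold_locales
      (auto simp: V'_def act'_def fg act_closed act_right act_left act_mid act_assoc)
  have inj: "inj_on g (carrier V)" by (metis fg inj_onI)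
  have prod: "products act' (carrier V') (carrier \<Gamma>) X = g ` products act (carrier V) (carrier \<Gamma>) X"
    if "X \<subseteq> carrier R" for X
    using that by (force simp: products_def V'_def act'_def fg act_closed image_iff)
  have prod_sub: "products act (carrier V) (carrier \<Gamma>) X \<subseteq> carrier V" if "X \<subseteq> carrier R" for X
    using that by (auto simp: products_def act_closed)
  have prod_one: "products act' (carrier V') (carrier \<Gamma>) X = {\<one>\<^bsub>V'\<^esub>} \<longleftrightarrow>
     products act (carrier V) (carrier \<Gamma>) X = {\<one>\<^bsub>V\<^esub>}" if "X \<subseteq> carrier R" for X
  proof -
    have "g ` P = g ` {\<one>\<^bsub>V\<^esub>} \<longleftrightarrow> P = {\<one>\<^bsub>V\<^esub>}" if "P \<subseteq> carrier V" for P
      by (rule inj_on_image_eq_iff[OF inj that]) simp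
    then show ?thesis using prod[OF that] prod_sub[OF that] by (simp add: V'_def)
  qed
  have hom: "group_hom V' V F"
    by unfold_locales (auto simp: hom_def V'_def fg)
  have "irreducible_gamma_module R \<Gamma> mul V' act'"
  proof
    show "products act' (carrier V') (carrier \<Gamma>) (carrier R) \<noteq> {\<one>\<^bsub>V'\<^esub>}"
      using nontrivial_action prod_one by auto
  next
    fix N' assume N': "gamma_submodule R \<Gamma> V' act' N'"
    define N where "N = F ` N'"
    have sub: "N' \<subseteq> g ` carrier V"
      using N' subgroup.subset by (force simp: gamma_submodule_def V'_def)
    then have gF: "g (F k) = k \<and> F k \<in> carrier V" if "k \<in> N'" for k using that fg by auto
    then have NN: "N' = g ` N" by (force simp: N_def image_iff)
    have "subgroup N V"
      unfolding N_def
      by (rule group_hom.subgroup_img_is_subgroup[OF hom]) (use N' in \<open>simp add: gamma_submodule_def\<close>)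
    moreover have "act p \<alpha> a \<in> N" if p: "p \<in> N" and "\<alpha> \<in> carrier \<Gamma>" "a \<in> carrier R" for p \<alpha> a
    proof -
      obtain k where k: "k \<in> N'" "p = F k" using p by (auto simp: N_def)
      then have "g (act p \<alpha> a) \<in> N'" using N' that by (auto simp: gamma_submodule_def act'_def)
      moreover have "act p \<alpha> a \<in> carrier V" using k gF that act_closed by auto
      ultimately show ?thesis using fg by (metis N_def image_eqI)
    qed
    ultimately have "N = {\<one>\<^bsub>V\<^esub>} \<or> N = carrier V"
      by (intro irreducible) (simp add: gamma_submodule_def)
    then show "N' = {\<one>\<^bsub>V'\<^esub>} \<or> N' = carrier V'" using NN by (auto simp: V'_def)
  qed
  then have "x \<in> gamma_annihilator R \<Gamma> V' act'"
    using x by (auto simp: gamma_radical_def)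
  then show ?thesis using prod_one[of "{x}"] by (simp add: gamma_annihilator_def)
qed

end

theory Submission
  imports Defs
begin

text \<open>
  In an irreducible regular moduloid \<open>M\<close> every \<open>w \<noteq> 0\<close> satisfies \<open>w\<delta>A = M\<close> for some \<open>\<delta>\<close>. So if
  \<open>w\<gamma>x \<noteq> 0\<close>, then \<open>w = w\<gamma>x\<delta>a = w\<gamma>y\<close> with \<open>y = x\<delta>a\<close>. Regularity makes the degree \<open>e\<close> of \<open>y\<close> a
  \<open>\<gamma>\<close>-idempotent and the addibility group of \<open>w\<close> equal to \<open>w\<gamma>A(e)\<close>; this group is an irreducible
  \<open>A(e)\<close>-module on which \<open>y\<close> acts nontrivially, so \<open>y \<notin> J(A(e))\<close>.

  Conversely, an irreducible \<open>A(e)\<close>-module \<open>V\<close> has the form \<open>v\<beta>A(e)\<close>. Send \<open>a \<in> A\<close> to the function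
  \<open>(\<delta>, c) \<mapsto> v\<beta>(a\<delta>c)\<close>, understood as \<open>0\<close> where \<open>a\<delta>c \<notin> A(e)\<close>. By regularity of \<open>A\<close> the image of \<open>A\<close> is
  an irreducible regular moduloid, and an element of \<open>A(e)\<close> that annihilates it also annihilates \<open>V\<close>.
\<close>

section \<open>Degrees, submoduloids and consequences of regularity\<close>

context homogroupoid
begin

lemma degrees_memI:
  assumes "\<xi> \<in> degrees H" "s \<in> \<xi>" "s \<noteq> hzero H" "t \<in> carrier H" "s \<sharp> t"
  shows "t \<in> \<xi>"
  using degrees_eq_addible_set[OF assms(1-3)] assms(4,5) by (simp add: addible_set_def)

end

context right_moduloid
begin

lemma act_hneg_left:
  assumes "w \<in> carrier M" "\<alpha> \<in> carrier G" "a \<in> carrier A"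
  shows "act (hneg M w) \<alpha> a = hneg M (act w \<alpha> a)"
proof (rule sym, rule M.hneg_eqI)
  show "act w \<alpha> a \<boxplus>\<^bsub>M\<^esub> act (hneg M w) \<alpha> a = hzero M"
    using act_left[of w "hneg M w" \<alpha> a] M.hneg[OF assms(1)] act_zero assms by metis
qed (use assms M.hneg act_closed act_left in auto)

text \<open>In an irreducible moduloid this submoduloid has to be zero, so every nonzero element is
  acted on nontrivially; \<open>cyclic\<close> starts from this.\<close>

lemma submoduloid_annihilated:
  "submoduloid A G M act {m \<in> carrier M. \<forall>\<delta>\<in>carrier G. \<forall>a\<in>carrier A. act m \<delta> a = hzero M}"
  (is "submoduloid A G M act ?N")
  unfolding submoduloid_def
proof (intro conjI ballI impI)
  show "?N \<noteq> {}" using M.zero_closed act_zero by auto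
next
  fix x y assume xy: "x \<in> ?N" "y \<in> ?N" "x \<sharp>\<^bsub>M\<^esub> y"
  then have c: "x \<in> carrier M" "hneg M y \<in> carrier M" "x \<sharp>\<^bsub>M\<^esub> hneg M y"
    using M.hneg M.addable_hneg by auto
  have "act (hdiff M x y) \<delta> a = hzero M" if "\<delta> \<in> carrier G" "a \<in> carrier A" for \<delta> a
    using xy c that act_left[OF c(1,2) that c(3)] act_hneg_left M.hneg_zero M.add_zero M.zero_closed
    by (simp add: hdiff_def)
  then show "hdiff M x y \<in> ?N" using c M.add_closed by (simp add: hdiff_def)
next
  fix x \<alpha> a assume "x \<in> ?N" "\<alpha> \<in> carrier G" "a \<in> carrier A"
  then show "act x \<alpha> a \<in> ?N"
    using act_zero M.zero_closed by auto
qed auto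

end

context regular_right_moduloid
begin

text \<open>Regularity gives closure under differences: if m\<delta>a and m\<delta>b are nonzero and
  addable, then \<open>a\<close> and \<open>b\<close> are addable, so the difference can be formed
  in \<open>A\<close> before acting. Regularity says nothing about zero values, which are therefore
  treated separately.\<close>

lemma submoduloid_orbit:
  assumes m: "m \<in> carrier M" and \<delta>: "\<delta> \<in> carrier G"
  shows "submoduloid A G M act (act m \<delta> ` carrier A)"
  unfolding submoduloid_def
proof (intro conjI ballI impI)
  show "act m \<delta> ` carrier A \<noteq> {}" using A.zero_closed by auto
  show "act m \<delta> ` carrier A \<subseteq> carrier M" using act_closed m \<delta> by auto
next
  fix x y assume "x \<in> act m \<delta> ` carrier A" "y \<in> act m \<delta> ` carrier A" and xy: "x \<sharp>\<^bsub>M\<^esub> y"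
  then obtain a b where ab: "a \<in> carrier A" "b \<in> carrier A" "x = act m \<delta> a" "y = act m \<delta> b"
    by auto
  note c = ab A.hneg(1)[OF ab(2)] act_closed[OF m \<delta> ab(1)] act_closed[OF m \<delta> ab(2)]
  consider "x = hzero M" | "y = hzero M" | "x \<noteq> hzero M" "y \<noteq> hzero M" by blast
  then show "hdiff M x y \<in> act m \<delta> ` carrier A"
  proof cases
    case 1
    then have "hdiff M x y = act m \<delta> (hneg A b)"
      using c act_hneg[OF m \<delta>] M.hneg(1) M.zero_add by (simp add: hdiff_def)
    then show ?thesis using c by auto
  next
    case 2
    then show ?thesis using c M.hneg_zero M.add_zero by (auto simp: hdiff_def)
  next
    case 3
    then have "a \<sharp>\<^bsub>A\<^esub> hneg A b"
      using regular[OF m \<delta> \<delta> ab(1,2)] ab xy A.addable_hneg by blast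
    then have "hdiff M x y = act m \<delta> (a \<boxplus>\<^bsub>A\<^esub> hneg A b) \<and> a \<boxplus>\<^bsub>A\<^esub> hneg A b \<in> carrier A"
      using act_right[OF m \<delta>] act_hneg[OF m \<delta>] A.add_closed c by (simp add: hdiff_def)
    then show ?thesis by blast
  qed
next
  fix x \<alpha> a assume "x \<in> act m \<delta> ` carrier A" "\<alpha> \<in> carrier G" "a \<in> carrier A"
  then show "act x \<alpha> a \<in> act m \<delta> ` carrier A"
    using act_assoc[OF m \<delta>, symmetric] mul_closed by auto
qed

text \<open>
  If \<open>act m \<delta> b\<close> and \<open>act n \<gamma> a\<close> both vanish, regularity is applied to \<open>m \<boxplus> n\<close>.
\<close>

lemma regular_addable:
  assumes m: "m \<in> carrier M" and n: "n \<in> carrier M" and mn: "m \<sharp>\<^bsub>M\<^esub> n"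
    and "\<gamma> \<in> carrier G" "\<delta> \<in> carrier G" "a \<in> carrier A" "b \<in> carrier A"
    and nz: "act m \<gamma> a \<noteq> hzero M" "act n \<delta> b \<noteq> hzero M"
    and ad: "act m \<gamma> a \<sharp>\<^bsub>M\<^esub> act n \<delta> b"
  shows "\<gamma> \<sharp>\<^bsub>G\<^esub> \<delta> \<and> a \<sharp>\<^bsub>A\<^esub> b"
proof -
  note c = assms(4-7) act_closed[OF m assms(4,6)] act_closed[OF n assms(4,6)]
    act_closed[OF m assms(5,7)] act_closed[OF n assms(5,7)]
  have 1: "act m \<gamma> a \<sharp>\<^bsub>M\<^esub> act n \<gamma> a" "act m \<delta> b \<sharp>\<^bsub>M\<^esub> act n \<delta> b"
    using act_left m n mn c by auto
  consider "act n \<gamma> a \<noteq> hzero M" | "act m \<delta> b \<noteq> hzero M"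
    | "act n \<gamma> a = hzero M" "act m \<delta> b = hzero M" by blast
  then show ?thesis
  proof cases
    case 1
    have "act n \<gamma> a \<sharp>\<^bsub>M\<^esub> act n \<delta> b"
      using M.addable_trans[OF c(6,5,8)] M.addable_sym \<open>act m \<gamma> a \<sharp>\<^bsub>M\<^esub> act n \<gamma> a\<close> c nz ad by blast
    then show ?thesis using regular[OF n] c 1 nz by blast
  next
    case 2
    have "act m \<gamma> a \<sharp>\<^bsub>M\<^esub> act m \<delta> b"
      using M.addable_trans[OF c(5,8,7)] M.addable_sym \<open>act m \<delta> b \<sharp>\<^bsub>M\<^esub> act n \<delta> b\<close> c nz ad by blast
    then show ?thesis using regular[OF m] c 2 nz by blast
  next
    case 3
    have s: "m \<boxplus>\<^bsub>M\<^esub> n \<in> carrier M" using M.add_closed m n mn by blast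
    have "act (m \<boxplus>\<^bsub>M\<^esub> n) \<gamma> a = act m \<gamma> a" "act (m \<boxplus>\<^bsub>M\<^esub> n) \<delta> b = act n \<delta> b"
      using act_left[OF m n _ _ mn] 3 c M.add_zero M.zero_add by auto
    then show ?thesis using regular[OF s] c nz ad by metis
  qed
qed

end

section \<open>Irreducible regular moduloids and their components\<close>

locale irreducible_regular_moduloid =
  irreducible_right_moduloid A G mul M act + regular_right_moduloid A G mul M act
  for A :: "'a homogroupoid" and G :: "'g homogroupoid" and mul :: "'a \<Rightarrow> 'g \<Rightarrow> 'a \<Rightarrow> 'a"
    and M :: "'m homogroupoid" and act :: "'m \<Rightarrow> 'g \<Rightarrow> 'a \<Rightarrow> 'm"
begin

lemma nontrivial_actionE:
  obtains w \<gamma> a where "w \<in> carrier M" "\<gamma> \<in> carrier G" "a \<in> carrier A" "act w \<gamma> a \<noteq> hzero M"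
proof -
  \<comment> \<open>\<open>nontrivial_action\<close> only says that the product set differs from
    {0}, so the empty set must be excluded before a nonzero product can be chosen.\<close>
  have "products act (carrier M) (carrier G) (carrier A) \<noteq> {}"
    using M.zero_closed G.zero_closed A.zero_closed by (auto simp: products_def)
  then obtain u where "u \<in> products act (carrier M) (carrier G) (carrier A)" "u \<noteq> hzero M"
    using nontrivial_action by blast
  then show ?thesis using that by (auto simp: products_def)
qed

text \<open>The elements killed by all of \<open>G\<close> and \<open>A\<close> form the zero
  submoduloid, so m\<delta>b \<noteq> 0 for some \<delta> and \<open>b\<close>. The orbit m\<delta>A
  of this single \<delta> is then a nonzero submoduloid, hence all of \<open>M\<close>.\<close>

lemma cyclic:
  assumes m: "m \<in> carrier M" "m \<noteq> hzero M"
  obtains \<delta> where "\<delta> \<in> carrier G" "act m \<delta> ` carrier A = carrier M"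
proof -
  let ?N = "{m \<in> carrier M. \<forall>\<delta>\<in>carrier G. \<forall>a\<in>carrier A. act m \<delta> a = hzero M}"
  obtain w \<gamma> a where "w \<in> carrier M" "\<gamma> \<in> carrier G" "a \<in> carrier A" "act w \<gamma> a \<noteq> hzero M"
    by (rule nontrivial_actionE)
  then have "?N \<noteq> carrier M" by blast
  then have "?N = {hzero M}" using irreducible[OF submoduloid_annihilated] by blast
  then have "m \<notin> ?N" using m by blast
  then obtain \<delta> b where 1: "\<delta> \<in> carrier G" "b \<in> carrier A" "act m \<delta> b \<noteq> hzero M"
    using m by blast
  then have "act m \<delta> ` carrier A = carrier M"
    using irreducible[OF submoduloid_orbit[OF m(1) 1(1)]] by blast
  then show ?thesis using that 1 by blast
qed

text \<open>The orbit w\<gamma>A contains w \<noteq> 0 and so is \<open>M\<close>. If a nonzero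
  w\<gamma>a is addable to w = w\<gamma>y, regularity makes \<open>a\<close> addable to
  \<open>y\<close>; zero is the image of zero.\<close>

lemma addible_set_idempotent:
  assumes w: "w \<in> carrier M" "w \<noteq> hzero M" and \<gamma>: "\<gamma> \<in> carrier G" and y: "y \<in> carrier A"
    and wy: "act w \<gamma> y = w"
  shows "addible_set M w = act w \<gamma> ` addible_set A y"
proof (intro equalityI subsetI)
  fix z assume "z \<in> addible_set M w"
  then have z: "z \<in> carrier M" "w \<sharp>\<^bsub>M\<^esub> z" by (auto simp: addible_set_def)
  have "act w \<gamma> ` carrier A = carrier M"
    using irreducible[OF submoduloid_orbit[OF w(1) \<gamma>]] w y wy by (metis image_eqI singletonD)
  then obtain a where a: "a \<in> carrier A" "z = act w \<gamma> a" using z by auto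
  show "z \<in> act w \<gamma> ` addible_set A y"
  proof (cases "z = hzero M")
    case True
    then show ?thesis
      using act_zero_right[OF w(1) \<gamma>] A.zero_closed A.addable_zero y
      by (intro image_eqI[of _ _ "hzero A"]) (auto simp: addible_set_def)
  next
    case False
    then show ?thesis
      using regular[OF w(1) \<gamma> \<gamma> y a(1)] wy w z a by (auto simp: addible_set_def)
  qed
next
  fix z assume "z \<in> act w \<gamma> ` addible_set A y"
  then show "z \<in> addible_set M w"
    using act_right[OF w(1) \<gamma> y] act_closed w \<gamma> wy by (auto simp: addible_set_def)
qed

text \<open>The moduloid axioms do not include additivity in \<open>G\<close>. Irreducibility
  supplies it: writing w = m\<delta>b turns w\<gamma>a into m\<delta>(b\<gamma>a), and
  multiplication in \<open>A\<close> is additive in the middle. This is what makes addibility groups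
  of \<open>M\<close> into gamma-modules.\<close>

lemma act_mid:
  assumes w: "w \<in> carrier M" and g: "\<gamma> \<in> carrier G" "\<gamma>' \<in> carrier G" "\<gamma> \<sharp>\<^bsub>G\<^esub> \<gamma>'" and a: "a \<in> carrier A"
  shows "act w \<gamma> a \<sharp>\<^bsub>M\<^esub> act w \<gamma>' a"
    and "act w (\<gamma> \<boxplus>\<^bsub>G\<^esub> \<gamma>') a = act w \<gamma> a \<boxplus>\<^bsub>M\<^esub> act w \<gamma>' a"
proof -
  obtain m \<delta> b where m: "m \<in> carrier M" "\<delta> \<in> carrier G" "b \<in> carrier A" "w = act m \<delta> b"
  proof -
    obtain m where m: "m \<in> carrier M" "m \<noteq> hzero M"
      using nontrivial_actionE act_closed by metis
    then obtain \<delta> where "\<delta> \<in> carrier G" "act m \<delta> ` carrier A = carrier M" by (rule cyclic)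
    then show ?thesis using that m w by blast
  qed
  have c: "\<gamma> \<boxplus>\<^bsub>G\<^esub> \<gamma>' \<in> carrier G" using g G.add_closed by blast
  have s: "act w \<epsilon> a = act m \<delta> (mul b \<epsilon> a)" if "\<epsilon> \<in> carrier G" for \<epsilon>
    using act_assoc[of m \<delta> b \<epsilon> a] m a that by simp
  show "act w \<gamma> a \<sharp>\<^bsub>M\<^esub> act w \<gamma>' a"
    "act w (\<gamma> \<boxplus>\<^bsub>G\<^esub> \<gamma>') a = act w \<gamma> a \<boxplus>\<^bsub>M\<^esub> act w \<gamma>' a"
    using s[OF g(1)] s[OF g(2)] s[OF c] mul_mid[OF m(3) g(1,2) a g(3)]
      act_right[OF m(1,2) mul_closed[OF m(3) g(1) a] mul_closed[OF m(3) g(2) a]] by auto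
qed

lemma act_zero_mid:
  assumes "w \<in> carrier M" "a \<in> carrier A"
  shows "act w (hzero G) a = hzero M"
  using act_mid(2)[of w "hzero G" "hzero G" a] G.zero_closed G.addable_zero G.add_zero assms
    M.idem_zero act_closed by metis

text \<open>A nonzero element \<open>n\<close> of a submodule generates \<open>M\<close>, so w =
  n\<delta>b. Comparing with w = w\<gamma>y, \<open>regular_addable\<close> puts \<delta> into
  G(\<gamma>) and \<open>b\<close> into A(y). Hence the submodule contains \<open>w\<close>, and
  with it w\<gamma>A(y), which is the whole group.\<close>

lemma irreducible_component:
  assumes w: "w \<in> carrier M" "w \<noteq> hzero M" and \<gamma>: "\<gamma> \<in> carrier G" "\<gamma> \<noteq> hzero G"
    and y: "y \<in> carrier A" "y \<noteq> hzero A" and wy: "act w \<gamma> y = w"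
    and id: "alpha_idempotent A G mul \<gamma> (addible_set A y)"
  shows "irreducible_gamma_module (on_set A (addible_set A y)) (on_set G (addible_set G \<gamma>)) mul
      (on_set M (addible_set M w)) act"
proof -
  interpret R: gamma_ring "on_set A (addible_set A y)" "on_set G (addible_set G \<gamma>)" mul
    by (rule component_gamma_ring[OF \<gamma> id])
  interpret V: comm_group "on_set M (addible_set M w)"
    by (rule M.comm_group_addible_set[OF w])
  note C = addible_set_idempotent[OF w \<gamma>(1) y(1) wy]
  have deg: "addible_set M w \<in> degrees M" "addible_set A y \<in> degrees A"
      "addible_set G \<gamma> \<in> degrees G"
    using w y \<gamma> by (auto simp: degrees_def)
  \<comment> \<open>The elements of the group have the form w\<gamma>r with \<open>r\<close> in
    A(y), so closure reduces to closure of A(y) under products through G(\<gamma>), which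
    idempotence provides.\<close>
  have cl: "act v \<delta> b \<in> addible_set M w"
    if vd: "v \<in> addible_set M w" and d: "\<delta> \<in> addible_set G \<gamma>" and b: "b \<in> addible_set A y" for v \<delta> b
  proof -
    obtain r where r: "r \<in> addible_set A y" "v = act w \<gamma> r" using vd C by auto
    have "mul r \<delta> b \<in> addible_set A y" using R.mul_closed r d b by (simp add: on_set_def)
    moreover have "act v \<delta> b = act w \<gamma> (mul r \<delta> b)"
      using act_assoc[OF w(1) \<gamma>(1)] r d b by (simp add: addible_set_def)
    ultimately show ?thesis using C by auto
  qed
  interpret V: gamma_module "on_set A (addible_set A y)" "on_set G (addible_set G \<gamma>)" mul
      "on_set M (addible_set M w)" act
  proof
    show "act v \<alpha> x \<in> carrier (on_set M (addible_set M w))"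
      if "v \<in> carrier (on_set M (addible_set M w))" "\<alpha> \<in> carrier (on_set G (addible_set G \<gamma>))"
        "x \<in> carrier (on_set A (addible_set A y))" for v \<alpha> x
      using that cl by (simp add: on_set_def)
  qed (use M.degrees_addable[OF deg(1)] A.degrees_addable[OF deg(2)] G.degrees_addable[OF deg(3)]
        act_left act_right act_mid(2) act_assoc in \<open>auto simp: on_set_def\<close>)
  have self: "w \<in> addible_set M w" "\<gamma> \<in> addible_set G \<gamma>" "y \<in> addible_set A y"
    using w \<gamma> y M.addable_refl G.addable_refl A.addable_refl by (auto simp: addible_set_def)
  show ?thesis
  proof
    have "w \<in> products act (addible_set M w) (addible_set G \<gamma>) (addible_set A y)"
      using self wy unfolding products_def by force
    then show "products act (carrier (on_set M (addible_set M w)))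
        (carrier (on_set G (addible_set G \<gamma>))) (carrier (on_set A (addible_set A y)))
          \<noteq> {\<one>\<^bsub>on_set M (addible_set M w)\<^esub>}"
      using w by (auto simp: on_set_def)
  next
    fix N assume N: "gamma_submodule (on_set A (addible_set A y)) (on_set G (addible_set G \<gamma>))
        (on_set M (addible_set M w)) act N"
    then have sub: "subgroup N (on_set M (addible_set M w))"
      and Nact: "\<And>v \<delta> b. v \<in> N \<Longrightarrow> \<delta> \<in> addible_set G \<gamma> \<Longrightarrow> b \<in> addible_set A y \<Longrightarrow> act v \<delta> b \<in> N"
      by (auto simp: gamma_submodule_def on_set_def)
    have N0: "hzero M \<in> N" "N \<subseteq> addible_set M w"
      using subgroup.one_closed[OF sub] subgroup.subset[OF sub] by (auto simp: on_set_def)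
    have "N = addible_set M w" if N1: "N \<noteq> {hzero M}"
    proof -
      obtain n where n: "n \<in> N" "n \<noteq> hzero M" using N1 N0(1) by auto
      have nM: "n \<in> carrier M" "w \<sharp>\<^bsub>M\<^esub> n" using n N0 by (auto simp: addible_set_def)
      obtain \<delta> where d: "\<delta> \<in> carrier G" "act n \<delta> ` carrier A = carrier M"
        by (rule cyclic[OF nM(1) n(2)])
      then obtain b where b: "b \<in> carrier A" "act n \<delta> b = w" using w by force
      have "\<gamma> \<sharp>\<^bsub>G\<^esub> \<delta> \<and> y \<sharp>\<^bsub>A\<^esub> b"
        using regular_addable[OF w(1) nM \<gamma>(1) d(1) y(1) b(1)] wy b w M.addable_refl by simp
      then have "w \<in> N" using Nact[OF n(1), of \<delta> b] d b by (simp add: addible_set_def)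
      then have "addible_set M w \<subseteq> N" unfolding C using Nact[OF _ self(2)] by auto
      then show ?thesis using N0(2) by (rule equalityI[rotated])
    qed
    then show "N = {\<one>\<^bsub>on_set M (addible_set M w)\<^esub>} \<or> N = carrier (on_set M (addible_set M w))"
      by (auto simp: on_set_def)
  qed
qed

end

text \<open>All products from A(y)G(\<gamma>)A(y) are addable to y\<gamma>y; since this is nonzero
  and addable to \<open>y\<close>, transitivity puts them all in A(y). Degrees sharing a nonzero
  element coincide, so A(y) is the only degree containing the products.\<close>

lemma (in anneid) alpha_idempotentI:
  assumes y: "y \<in> carrier A" "y \<noteq> hzero A" and \<gamma>: "\<gamma> \<in> carrier G" "\<gamma> \<noteq> hzero G"
    and yy: "mul y \<gamma> y \<noteq> hzero A" "y \<sharp>\<^bsub>A\<^esub> mul y \<gamma> y"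
  shows "alpha_idempotent A G mul \<gamma> (addible_set A y)"
proof -
  let ?e = "addible_set A y" and ?d = "addible_set G \<gamma>"
  have e: "?e \<in> degrees A" using y by (auto simp: degrees_def)
  have self: "\<gamma> \<in> ?d" "y \<in> ?e"
    using \<gamma> y G.addable_refl A.addable_refl by (auto simp: addible_set_def)
  have P: "mul y \<gamma> y \<in> products mul ?e ?d ?e" using self by (auto simp: products_def)
  have yyc: "mul y \<gamma> y \<in> carrier A" using y \<gamma> mul_closed by blast
  have sub: "products mul ?e ?d ?e \<subseteq> ?e"
  proof
    fix z assume "z \<in> products mul ?e ?d ?e"
    then obtain a \<delta> b where z: "a \<in> ?e" "\<delta> \<in> ?d" "b \<in> ?e" "z = mul a \<delta> b"
      by (auto simp: products_def)
    then have "mul y \<gamma> y \<sharp>\<^bsub>A\<^esub> z" "z \<in> carrier A"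
      using products_addable mul_closed y \<gamma> by (auto simp: addible_set_def)
    then show "z \<in> ?e"
      using A.addable_trans[OF y(1) yyc _ yy(2) _ yy(1)] by (simp add: addible_set_def)
  qed
  have "(THE \<zeta>. \<zeta> \<in> degrees A \<and> products mul ?e ?d ?e \<subseteq> \<zeta>) = ?e"
  proof (rule the_equality)
    fix \<zeta> assume "\<zeta> \<in> degrees A \<and> products mul ?e ?d ?e \<subseteq> \<zeta>"
    then show "\<zeta> = ?e"
      using P yy(1) A.degrees_eq_addible_set[of \<zeta> "mul y \<gamma> y"]
        A.degrees_eq_addible_set[OF e, of "mul y \<gamma> y"] sub by blast
  qed (use e sub in simp)
  then show ?thesis
    using P yy(1) e \<gamma> by (auto simp: alpha_idempotent_def degree_product_def degree_def)
qed

section \<open>The moduloid induced by an irreducible module\<close>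

context irreducible_gamma_module
begin

lemma act_one:
  assumes "\<gamma> \<in> carrier \<Gamma>" "a \<in> carrier R"
  shows "act \<one>\<^bsub>V\<^esub> \<gamma> a = \<one>\<^bsub>V\<^esub>"
  using act_left[of "\<one>\<^bsub>V\<^esub>" "\<one>\<^bsub>V\<^esub>" \<gamma> a] act_closed[of "\<one>\<^bsub>V\<^esub>" \<gamma> a] assms by simp

lemma act_one_right:
  assumes "v \<in> carrier V" "\<gamma> \<in> carrier \<Gamma>"
  shows "act v \<gamma> \<one>\<^bsub>R\<^esub> = \<one>\<^bsub>V\<^esub>"
  using act_right[of v \<gamma> "\<one>\<^bsub>R\<^esub>" "\<one>\<^bsub>R\<^esub>"] act_closed[of v \<gamma> "\<one>\<^bsub>R\<^esub>"] assms by simp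

lemma nontrivial_actionE:
  obtains v \<gamma> a where "v \<in> carrier V" "\<gamma> \<in> carrier \<Gamma>" "a \<in> carrier R" "act v \<gamma> a \<noteq> \<one>\<^bsub>V\<^esub>"
proof -
  have "products act (carrier V) (carrier \<Gamma>) (carrier R) \<noteq> {}"
    using V.one_closed \<Gamma>.one_closed R.one_closed unfolding products_def by blast
  then obtain u where "u \<in> products act (carrier V) (carrier \<Gamma>) (carrier R)" "u \<noteq> \<one>\<^bsub>V\<^esub>"
    using nontrivial_action by blast
  then show ?thesis using that by (auto simp: products_def)
qed

text \<open>As for moduloids: the elements killed by everything form the zero submodule, so some
  \<delta> gives a nonzero orbit of \<open>v\<close>. The orbit is a subgroup because it is the
  image of a group homomorphism.\<close>

lemma cyclic:
  assumes v: "v \<in> carrier V" "v \<noteq> \<one>\<^bsub>V\<^esub>"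
  obtains \<delta> where "\<delta> \<in> carrier \<Gamma>" "act v \<delta> ` carrier R = carrier V"
proof -
  let ?N = "{v \<in> carrier V. \<forall>\<delta>\<in>carrier \<Gamma>. \<forall>a\<in>carrier R. act v \<delta> a = \<one>\<^bsub>V\<^esub>}"
  have "subgroup ?N V"
  proof (rule V.subgroupI)
    fix a assume a: "a \<in> ?N"
    have "act (inv\<^bsub>V\<^esub> a) \<delta> b = \<one>\<^bsub>V\<^esub>" if db: "\<delta> \<in> carrier \<Gamma>" "b \<in> carrier R" for \<delta> b
    proof -
      have aV: "a \<in> carrier V" "act a \<delta> b = \<one>\<^bsub>V\<^esub>" using a db by auto
      have "act (inv\<^bsub>V\<^esub> a \<otimes>\<^bsub>V\<^esub> a) \<delta> b = act (inv\<^bsub>V\<^esub> a) \<delta> b \<otimes>\<^bsub>V\<^esub> act a \<delta> b"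
        by (rule act_left) (use aV db in auto)
      then show ?thesis using aV act_one[OF db] act_closed[OF _ db, of "inv\<^bsub>V\<^esub> a"] by simp
    qed
    then show "inv\<^bsub>V\<^esub> a \<in> ?N" using a by simp
  qed (use act_one act_left in auto)
  then have sub1: "gamma_submodule R \<Gamma> V act ?N"
    using act_one by (auto simp: gamma_submodule_def)
  obtain w \<gamma> a where "w \<in> carrier V" "\<gamma> \<in> carrier \<Gamma>" "a \<in> carrier R" "act w \<gamma> a \<noteq> \<one>\<^bsub>V\<^esub>"
    by (rule nontrivial_actionE)
  then have "?N \<noteq> carrier V" by blast
  then have "?N = {\<one>\<^bsub>V\<^esub>}" using irreducible[OF sub1] by blast
  then have "v \<notin> ?N" using v by blast
  then obtain \<delta> b where 1: "\<delta> \<in> carrier \<Gamma>" "b \<in> carrier R" "act v \<delta> b \<noteq> \<one>\<^bsub>V\<^esub>"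
    using v by blast
  have "group_hom R V (act v \<delta>)"
    by unfold_locales (use act_closed act_right v 1 in \<open>auto simp: hom_def\<close>)
  then have "subgroup (act v \<delta> ` carrier R) V"
    using group_hom.img_is_subgroup by blast
  moreover have "act (act v \<delta> a) \<alpha> x \<in> act v \<delta> ` carrier R"
    if "a \<in> carrier R" "\<alpha> \<in> carrier \<Gamma>" "x \<in> carrier R" for a \<alpha> x
    using act_assoc[of v \<delta> a \<alpha> x] v 1 that mul_closed by auto
  ultimately have "gamma_submodule R \<Gamma> V act (act v \<delta> ` carrier R)"
    by (auto simp: gamma_submodule_def)
  then have "act v \<delta> ` carrier R = carrier V" using irreducible 1 by blast
  then show ?thesis using that 1 by blast
qed

end


section \<open>Coordinate functions and their homogroupoid\<close>

locale induced_moduloid =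
  r: regular_right_moduloid A G mul A mul + l: regular_left_moduloid A G mul A mul +
  V: irreducible_gamma_module "on_set A e" "on_set G (addible_set G \<alpha>)" mul V act
  for A :: "'a homogroupoid" and G :: "'g homogroupoid" and mul :: "'a \<Rightarrow> 'g \<Rightarrow> 'a \<Rightarrow> 'a"
    and e \<alpha> and V :: "'v monoid" and act :: "'v \<Rightarrow> 'g \<Rightarrow> 'a \<Rightarrow> 'v" +
  fixes v :: 'v and \<beta> :: 'g
  assumes e: "e \<in> degrees A"
    and v: "v \<in> carrier V" "v \<noteq> \<one>\<^bsub>V\<^esub>" and \<beta>: "\<beta> \<in> addible_set G \<alpha>"
    and generates: "act v \<beta> ` e = carrier V"
begin

text \<open>Extends the homomorphism s \<mapsto> v\<beta>s from \<open>e\<close> to all of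
  \<open>A\<close> by the zero of \<open>V\<close>, like a projection onto the component
  \<open>e\<close>.\<close>

definition component :: "'a \<Rightarrow> 'v" where
  "component s = (if s \<in> e then act v \<beta> s else \<one>\<^bsub>V\<^esub>)"

text \<open>
  \<open>coord\<close> identifies \<open>a\<close> and \<open>b\<close> when \<open>a - b\<close> lies in the largest submoduloid of \<open>A\<close> whose
  intersection with \<open>e\<close> annihilates \<open>v\<close> under \<open>\<beta>\<close>, so \<open>induced\<close> is a model of the quotient.
\<close>

definition coord :: "'a \<Rightarrow> 'g \<times> 'a \<Rightarrow> 'v" where
  "coord a = (\<lambda>(\<delta>, c). if \<delta> \<in> carrier G \<and> c \<in> carrier A then component (mul a \<delta> c) else \<one>\<^bsub>V\<^esub>)"

definition induced :: "('g \<times> 'a \<Rightarrow> 'v) homogroupoid" where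
  "induced = \<lparr>carrier = coord ` carrier A,
     addable = (\<lambda>f g. \<exists>a\<in>carrier A. \<exists>b\<in>carrier A. a \<sharp>\<^bsub>A\<^esub> b \<and> f = coord a \<and> g = coord b),
     hadd = (\<lambda>f g p. f p \<otimes>\<^bsub>V\<^esub> g p), hzero = (\<lambda>_. \<one>\<^bsub>V\<^esub>)\<rparr>"

text \<open>Dictated by (a\<gamma>b)\<delta>c = a\<gamma>(b\<delta>c): the value of
  \<open>coord (mul a \<gamma> b)\<close> at (\<delta>, c) is the value of \<open>coord a\<close> at
  (\<gamma>, b\<delta>c). Acting on functions in this way avoids a choice of
  representatives.\<close>

definition induced_act :: "('g \<times> 'a \<Rightarrow> 'v) \<Rightarrow> 'g \<Rightarrow> 'a \<Rightarrow> 'g \<times> 'a \<Rightarrow> 'v" where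
  "induced_act f \<gamma> b =
     (\<lambda>(\<delta>, c). if \<delta> \<in> carrier G \<and> c \<in> carrier A then f (\<gamma>, mul b \<delta> c) else \<one>\<^bsub>V\<^esub>)"

lemma \<beta>_closed: "\<beta> \<in> carrier G"
  using \<beta> by (simp add: addible_set_def)

lemma e_closed: "s \<in> e \<Longrightarrow> s \<in> carrier A"
  using r.A.degrees_addable(1)[OF e] by blast

lemma act_closed: "\<lbrakk>w \<in> carrier V; \<gamma> \<in> addible_set G \<alpha>; s \<in> e\<rbrakk> \<Longrightarrow> act w \<gamma> s \<in> carrier V"
  using V.act_closed by (simp add: on_set_def)

lemma mul_closed: "\<lbrakk>s \<in> e; \<gamma> \<in> addible_set G \<alpha>; t \<in> e\<rbrakk> \<Longrightarrow> mul s \<gamma> t \<in> e"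
  using V.mul_closed by (simp add: on_set_def)

lemma act_assoc:
  "\<lbrakk>w \<in> carrier V; \<gamma> \<in> addible_set G \<alpha>; s \<in> e; \<delta> \<in> addible_set G \<alpha>; t \<in> e\<rbrakk>
    \<Longrightarrow> act (act w \<gamma> s) \<delta> t = act w \<gamma> (mul s \<delta> t)"
  using V.act_assoc by (simp add: on_set_def)

lemma act_zero_right: "\<lbrakk>w \<in> carrier V; \<gamma> \<in> addible_set G \<alpha>\<rbrakk> \<Longrightarrow> act w \<gamma> (hzero A) = \<one>\<^bsub>V\<^esub>"
  using V.act_one_right by (simp add: on_set_def)

lemma component_closed: "component s \<in> carrier V"
  using act_closed v \<beta> by (simp add: component_def)

lemma component_zero: "component (hzero A) = \<one>\<^bsub>V\<^esub>"
  using act_zero_right v \<beta> by (simp add: component_def)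

text \<open>Nonzero addable elements have the same degree, so they lie both in \<open>e\<close> or
  both outside it. In the latter case a nonzero sum is outside \<open>e\<close> too, being addable
  to its summands, and all three values are zero.\<close>

lemma component_add:
  assumes "s \<in> carrier A" "t \<in> carrier A" and st: "s \<sharp>\<^bsub>A\<^esub> t"
  shows "component (s \<boxplus>\<^bsub>A\<^esub> t) = component s \<otimes>\<^bsub>V\<^esub> component t"
proof -
  consider "s = hzero A" | "t = hzero A" | "s \<in> e" "t \<in> e"
    | "s \<noteq> hzero A" "t \<noteq> hzero A" "s \<notin> e" "t \<notin> e"
    using assms r.A.degrees_memI[OF e] r.A.addable_sym by blast
  then show ?thesis
  proof cases
    case 1
    then show ?thesis using assms r.A.zero_add component_zero component_closed by simp
  next
    case 2
    then show ?thesis using assms r.A.add_zero component_zero component_closed by simp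
  next
    case 3
    have "s \<otimes>\<^bsub>on_set A e\<^esub> t \<in> carrier (on_set A e)"
      by (rule V.R.m_closed) (use 3 in \<open>simp_all add: on_set_def\<close>)
    then show ?thesis
      using 3 V.act_right[of v \<beta> s t] v \<beta> by (simp add: component_def on_set_def)
  next
    case 4
    have sum: "s \<boxplus>\<^bsub>A\<^esub> t \<in> carrier A" using assms r.A.add_closed by blast
    have "s \<sharp>\<^bsub>A\<^esub> s \<boxplus>\<^bsub>A\<^esub> t" using assms r.A.addable_add r.A.addable_refl by blast
    then have "s \<boxplus>\<^bsub>A\<^esub> t \<sharp>\<^bsub>A\<^esub> s" using assms sum r.A.addable_sym by blast
    then have "s \<boxplus>\<^bsub>A\<^esub> t = hzero A \<or> s \<boxplus>\<^bsub>A\<^esub> t \<notin> e"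
      using 4(3) r.A.degrees_memI[OF e _ _ assms(1)] by blast
    then show ?thesis using 4 component_zero by (auto simp: component_def)
  qed
qed

lemma coord_zero: "coord (hzero A) = (\<lambda>_. \<one>\<^bsub>V\<^esub>)"
  using r.act_zero component_zero by (auto simp: coord_def fun_eq_iff)

lemma coord_add:
  assumes "a \<in> carrier A" "b \<in> carrier A" "a \<sharp>\<^bsub>A\<^esub> b"
  shows "coord (a \<boxplus>\<^bsub>A\<^esub> b) = (\<lambda>p. coord a p \<otimes>\<^bsub>V\<^esub> coord b p)"
  using assms r.mul_left component_add r.mul_closed by (auto simp: coord_def fun_eq_iff)

text \<open>At a coordinate (\<delta>, c) with nonzero value, a\<delta>c and b\<delta>c are nonzero
  elements of \<open>e\<close>, hence addable; left regularity of \<open>A\<close> then cancels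
  \<delta> and \<open>c\<close>.\<close>

lemma coord_eq_addable:
  assumes a: "a \<in> carrier A" "b \<in> carrier A"
    and eq: "coord a = coord b" and nz: "coord a \<noteq> (\<lambda>_. \<one>\<^bsub>V\<^esub>)"
  shows "a \<sharp>\<^bsub>A\<^esub> b"
proof -
  obtain p where p: "coord a p \<noteq> \<one>\<^bsub>V\<^esub>" using nz by blast
  obtain \<delta> c where p': "p = (\<delta>, c)" by (cases p)
  have d: "\<delta> \<in> carrier G" "c \<in> carrier A"
    using p p' by (auto simp: coord_def split: if_splits)
  have n: "component (mul a \<delta> c) \<noteq> \<one>\<^bsub>V\<^esub>" "component (mul b \<delta> c) \<noteq> \<one>\<^bsub>V\<^esub>"
    using p p' d fun_cong[OF eq, of p] by (auto simp: coord_def)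
  then have "mul a \<delta> c \<in> e" "mul b \<delta> c \<in> e" by (auto simp: component_def split: if_splits)
  moreover have "mul a \<delta> c \<noteq> hzero A" "mul b \<delta> c \<noteq> hzero A" using n component_zero by metis+
  ultimately show ?thesis
    using l.regular[OF d(2) d(1) d(1) a] r.A.degrees_addable(3)[OF e] by blast
qed

lemma induced_act_coord:
  assumes "a \<in> carrier A" "\<gamma> \<in> carrier G" "b \<in> carrier A"
  shows "induced_act (coord a) \<gamma> b = coord (mul a \<gamma> b)"
  using assms r.mul_assoc r.mul_closed by (auto simp: induced_act_def coord_def fun_eq_iff)

text \<open>Addability in \<open>induced\<close> is witnessed by some pair of addable
  representatives. For nonzero functions \<open>coord_eq_addable\<close> links these to any other
  representatives, so addability can be tested on every pair.\<close>

lemma coord_addable: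
  assumes "a \<in> carrier A" "b \<in> carrier A" "coord a \<sharp>\<^bsub>induced\<^esub> coord b"
    and nz: "coord a \<noteq> hzero induced" "coord b \<noteq> hzero induced"
  shows "a \<sharp>\<^bsub>A\<^esub> b"
proof -
  obtain a' b' where ab: "a' \<in> carrier A" "b' \<in> carrier A" "a' \<sharp>\<^bsub>A\<^esub> b'"
    "coord a = coord a'" "coord b = coord b'"
    using assms(3) by (auto simp: induced_def)
  have z: "coord a \<noteq> (\<lambda>_. \<one>\<^bsub>V\<^esub>)" "coord b \<noteq> (\<lambda>_. \<one>\<^bsub>V\<^esub>)" using nz by (auto simp: induced_def)
  have "a \<sharp>\<^bsub>A\<^esub> a'" "b' \<sharp>\<^bsub>A\<^esub> b"
    using coord_eq_addable[OF assms(1) ab(1)] coord_eq_addable[OF ab(2) assms(2)] z ab by auto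
  moreover have "a' \<noteq> hzero A" "b' \<noteq> hzero A" using coord_zero z ab by auto
  ultimately show ?thesis
    using r.A.addable_trans[OF assms(1) ab(1) ab(2)] r.A.addable_trans[OF assms(1) ab(2) assms(2)]
      ab(3) by blast
qed

lemma coord_addableI:
  "\<lbrakk>a \<in> carrier A; b \<in> carrier A; a \<sharp>\<^bsub>A\<^esub> b\<rbrakk> \<Longrightarrow> coord a \<sharp>\<^bsub>induced\<^esub> coord b"
  by (auto simp: induced_def)

lemma carrier_induced: "carrier induced = coord ` carrier A"
  by (simp add: induced_def)

lemma hzero_induced: "hzero induced = coord (hzero A)"
  by (simp add: induced_def coord_zero)

lemma hadd_induced:
  "\<lbrakk>a \<in> carrier A; b \<in> carrier A; a \<sharp>\<^bsub>A\<^esub> b\<rbrakk> \<Longrightarrow> coord a \<boxplus>\<^bsub>induced\<^esub> coord b = coord (a \<boxplus>\<^bsub>A\<^esub> b)"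
  by (simp add: induced_def coord_add)

lemma homogroupoid_induced: "homogroupoid induced"
proof (rule homogroupoid.intro)
  show "hzero induced \<in> carrier induced"
    using r.A.zero_closed by (simp add: hzero_induced carrier_induced)
next
  fix f g assume "f \<sharp>\<^bsub>induced\<^esub> g"
  then obtain a b where ab: "a \<in> carrier A" "b \<in> carrier A" "a \<sharp>\<^bsub>A\<^esub> b" "f = coord a" "g = coord b"
    by (auto simp: induced_def)
  show "f \<boxplus>\<^bsub>induced\<^esub> g \<in> carrier induced"
    using ab hadd_induced r.A.add_closed by (simp add: carrier_induced)
  show "g \<sharp>\<^bsub>induced\<^esub> f"
    using ab r.A.addable_sym coord_addableI by blast
  show "f \<boxplus>\<^bsub>induced\<^esub> g = g \<boxplus>\<^bsub>induced\<^esub> f"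
    using ab r.A.addable_sym r.A.add_commute hadd_induced by metis
next
  fix f assume "f \<in> carrier induced"
  then obtain a where a: "a \<in> carrier A" "f = coord a" by (auto simp: carrier_induced)
  show "f \<sharp>\<^bsub>induced\<^esub> hzero induced"
    using a r.A.addable_zero r.A.zero_closed coord_addableI by (simp add: hzero_induced)
  show "f \<boxplus>\<^bsub>induced\<^esub> hzero induced = f"
    using a r.A.addable_zero r.A.zero_closed hadd_induced r.A.add_zero by (simp add: hzero_induced)
  show "f \<sharp>\<^bsub>induced\<^esub> f"
    using a r.A.addable_refl coord_addableI by blast
next
  fix f g h assume f: "f \<in> carrier induced" "g \<in> carrier induced" "h \<in> carrier induced"
    and fgh: "f \<sharp>\<^bsub>induced\<^esub> g" "g \<sharp>\<^bsub>induced\<^esub> h" and nz: "g \<noteq> hzero induced"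
  obtain a b where ab: "a \<in> carrier A" "b \<in> carrier A" "a \<sharp>\<^bsub>A\<^esub> b" "f = coord a" "g = coord b"
    using fgh by (auto simp: induced_def)
  obtain b' c where bc: "b' \<in> carrier A" "c \<in> carrier A" "b' \<sharp>\<^bsub>A\<^esub> c" "g = coord b'" "h = coord c"
    using fgh by (auto simp: induced_def)
  have b0: "b \<noteq> hzero A" "b' \<noteq> hzero A" using nz ab bc hzero_induced by auto
  \<comment> \<open>The two addable pairs may represent \<open>g\<close> by different elements. As
    \<open>g\<close> is nonzero, these are addable to each other, which joins the pairs in
    \<open>A\<close>.\<close>
  have "b \<sharp>\<^bsub>A\<^esub> b'"
    using coord_eq_addable[OF ab(2) bc(1)] nz ab bc by (auto simp: induced_def)
  then have "a \<sharp>\<^bsub>A\<^esub> c"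
    using r.A.addable_trans[OF ab(1,2) bc(1)] r.A.addable_trans[OF ab(1) bc(1,2)] ab bc b0 by blast
  then show "f \<sharp>\<^bsub>induced\<^esub> h" using ab bc coord_addableI by blast
next
  fix f assume "f \<in> carrier induced" and nz: "f \<noteq> hzero induced"
  then obtain a where a: "a \<in> carrier A" "f = coord a" by (auto simp: carrier_induced)
  have a0: "a \<noteq> hzero A" using nz a hzero_induced by auto
  interpret K: group "on_set A (addible_set A a)" using r.A.addibility_group[OF a(1) a0] .
  \<comment> \<open>The group of \<open>f\<close> is the image of the group of \<open>a\<close>. The
    zero function needs its own case because \<open>coord_addable\<close> only covers nonzero
    functions.\<close>
  have im: "addible_set induced f = coord ` addible_set A a"
  proof (intro equalityI subsetI)
    fix g assume "g \<in> addible_set induced f"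
    then obtain b where b: "b \<in> carrier A" "g = coord b" "coord a \<sharp>\<^bsub>induced\<^esub> coord b"
      using a by (auto simp: addible_set_def carrier_induced)
    show "g \<in> coord ` addible_set A a"
    proof (cases "g = hzero induced")
      case True
      then show ?thesis
        using hzero_induced a r.A.zero_closed r.A.addable_zero by (auto simp: addible_set_def)
    next
      case False
      then show ?thesis
        using coord_addable[OF a(1) b(1)] a b nz by (auto simp: addible_set_def)
    qed
  qed (use a coord_addableI in \<open>auto simp: addible_set_def carrier_induced\<close>)
  have K: "coord b \<boxplus>\<^bsub>induced\<^esub> coord c = coord (b \<otimes>\<^bsub>on_set A (addible_set A a)\<^esub> c)"
    if "b \<in> addible_set A a" "c \<in> addible_set A a" for b c
    using hadd_induced[OF _ _ r.A.addible_set_addable[OF a(1) a0 that]] that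
    by (simp add: on_set_def addible_set_def)
  show "group (on_set induced (addible_set induced f))"
  proof (rule groupI)
    let ?I = "on_set induced (addible_set induced f)"
    let ?A = "on_set A (addible_set A a)"
    have c: "carrier ?I = coord ` carrier ?A" by (simp add: on_set_def im)
    have m: "coord b \<otimes>\<^bsub>?I\<^esub> coord c = coord (b \<otimes>\<^bsub>?A\<^esub> c)"
      if "b \<in> carrier ?A" "c \<in> carrier ?A" for b c
      using K[of b c] that by (simp add: on_set_def)
    have o: "\<one>\<^bsub>?I\<^esub> = coord \<one>\<^bsub>?A\<^esub>" by (simp add: on_set_def hzero_induced)
    show "x \<otimes>\<^bsub>?I\<^esub> y \<in> carrier ?I" if "x \<in> carrier ?I" "y \<in> carrier ?I" for x y
      using that m unfolding c by auto
    show "\<one>\<^bsub>?I\<^esub> \<in> carrier ?I" unfolding c o by simp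
    show "x \<otimes>\<^bsub>?I\<^esub> y \<otimes>\<^bsub>?I\<^esub> z = x \<otimes>\<^bsub>?I\<^esub> (y \<otimes>\<^bsub>?I\<^esub> z)"
      if "x \<in> carrier ?I" "y \<in> carrier ?I" "z \<in> carrier ?I" for x y z
      using that m K.m_assoc unfolding c by auto
    show "\<one>\<^bsub>?I\<^esub> \<otimes>\<^bsub>?I\<^esub> x = x" if "x \<in> carrier ?I" for x
      using that m unfolding c o by auto
    show "\<exists>y\<in>carrier ?I. y \<otimes>\<^bsub>?I\<^esub> x = \<one>\<^bsub>?I\<^esub>" if "x \<in> carrier ?I" for x
    proof -
      obtain b where b: "b \<in> carrier ?A" "x = coord b" using \<open>x \<in> carrier ?I\<close> c by auto
      then obtain b' where "b' \<in> carrier ?A" "b' \<otimes>\<^bsub>?A\<^esub> b = \<one>\<^bsub>?A\<^esub>" using K.l_inv_ex by blast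
      then show ?thesis using m b c o by (metis image_eqI)
    qed
  qed
qed

section \<open>Moduloid axioms, regularity and irreducibility of \<open>induced\<close>\<close>

lemma right_moduloid_induced: "right_moduloid A G mul induced induced_act"
proof (intro right_moduloid.intro right_moduloid_axioms.intro)
  show "anneid A G mul" by unfold_locales
  show "homogroupoid induced" by (rule homogroupoid_induced)
next
  fix f \<gamma> x assume "f \<in> carrier induced" and x: "\<gamma> \<in> carrier G" "x \<in> carrier A"
  then obtain a where a: "a \<in> carrier A" "f = coord a" by (auto simp: carrier_induced)
  show "induced_act f \<gamma> x \<in> carrier induced"
    using a x induced_act_coord r.mul_closed by (simp add: carrier_induced)
  show "induced_act f \<gamma> x \<sharp>\<^bsub>induced\<^esub> induced_act f \<gamma> y \<and>
      induced_act f \<gamma> (x \<boxplus>\<^bsub>A\<^esub> y) = induced_act f \<gamma> x \<boxplus>\<^bsub>induced\<^esub> induced_act f \<gamma> y"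
    if "y \<in> carrier A" "x \<sharp>\<^bsub>A\<^esub> y" for y
    using a x that induced_act_coord r.mul_closed r.mul_right[OF a(1) x that] coord_addableI
      hadd_induced r.A.add_closed by simp
  show "induced_act f \<gamma> (mul x \<delta> y) = induced_act (induced_act f \<gamma> x) \<delta> y"
    if "\<delta> \<in> carrier G" "y \<in> carrier A" for \<delta> y
    using a x that induced_act_coord r.mul_closed r.mul_assoc by simp
next
  fix f g \<gamma> x assume "f \<sharp>\<^bsub>induced\<^esub> g" and x: "\<gamma> \<in> carrier G" "x \<in> carrier A"
  then obtain a b where ab: "a \<in> carrier A" "b \<in> carrier A" "a \<sharp>\<^bsub>A\<^esub> b" "f = coord a" "g = coord b"
    by (auto simp: induced_def)
  show "induced_act f \<gamma> x \<sharp>\<^bsub>induced\<^esub> induced_act g \<gamma> x \<and>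
      induced_act (f \<boxplus>\<^bsub>induced\<^esub> g) \<gamma> x = induced_act f \<gamma> x \<boxplus>\<^bsub>induced\<^esub> induced_act g \<gamma> x"
    using ab x induced_act_coord r.mul_closed r.mul_left[OF ab(1,2) x ab(3)] coord_addableI
      hadd_induced r.A.add_closed by simp
qed

lemma regular_induced: "regular_right_moduloid A G mul induced induced_act"
proof (intro regular_right_moduloid.intro regular_right_moduloid_axioms.intro)
  show "right_moduloid A G mul induced induced_act" by (rule right_moduloid_induced)
next
  fix f \<gamma> \<delta> x y
  assume "f \<in> carrier induced" and x: "\<gamma> \<in> carrier G" "\<delta> \<in> carrier G" "x \<in> carrier A" "y \<in> carrier A"
    and nz: "induced_act f \<gamma> x \<noteq> hzero induced" "induced_act f \<delta> y \<noteq> hzero induced"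
    and ad: "induced_act f \<gamma> x \<sharp>\<^bsub>induced\<^esub> induced_act f \<delta> y"
  then obtain a where a: "a \<in> carrier A" "f = coord a" by (auto simp: carrier_induced)
  have eq: "induced_act f \<gamma> x = coord (mul a \<gamma> x)" "induced_act f \<delta> y = coord (mul a \<delta> y)"
    using a x induced_act_coord by auto
  have c: "mul a \<gamma> x \<in> carrier A" "mul a \<delta> y \<in> carrier A" using a x r.mul_closed by auto
  have "mul a \<gamma> x \<sharp>\<^bsub>A\<^esub> mul a \<delta> y" using coord_addable[OF c] eq nz ad by simp
  moreover have "mul a \<gamma> x \<noteq> hzero A" "mul a \<delta> y \<noteq> hzero A" using nz eq hzero_induced by auto
  ultimately show "\<gamma> \<sharp>\<^bsub>G\<^esub> \<delta> \<and> x \<sharp>\<^bsub>A\<^esub> y" using r.regular[OF a(1) x] by blast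
qed

text \<open>
  If \<open>z\<close> represents \<open>v\<close>, regularity forces \<open>c \<in> e\<close> whenever \<open>0 \<noteq> mul z \<beta> c \<in> e\<close>.
\<close>

lemma component_mul:
  assumes z: "z \<in> e" "act v \<beta> z = v" and c: "c \<in> carrier A"
  shows "component (mul z \<beta> c) = component c"
proof -
  have assoc: "act v \<beta> (mul z \<beta> s) = act v \<beta> s" if "s \<in> e" for s
    using act_assoc[OF v(1) \<beta> z(1) \<beta> that] unfolding z(2) by (rule sym)
  show ?thesis
  proof (cases "c \<in> e")
    case True
    then show ?thesis using assoc mul_closed[OF z(1) \<beta>] by (simp add: component_def)
  next
    case c_not: False
    have "mul z \<beta> c = hzero A" if mem: "mul z \<beta> c \<in> e"
    proof (rule ccontr)
      assume nz: "mul z \<beta> c \<noteq> hzero A"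
      \<comment> \<open>The product z\<beta>z serves for comparison: it lies in \<open>e\<close> and
        is nonzero because v\<beta>(z\<beta>z) = v. Both z\<beta>z and z\<beta>c are thus nonzero in
        \<open>e\<close>, and right regularity applies.\<close>
      have zz: "mul z \<beta> z \<in> e" using mul_closed z(1) \<beta> by blast
      have "act v \<beta> (mul z \<beta> z) = v" using assoc z by simp
      then have "mul z \<beta> z \<noteq> hzero A" using act_zero_right[OF v(1) \<beta>] v by metis
      then have "z \<sharp>\<^bsub>A\<^esub> c"
        using r.regular[OF e_closed[OF z(1)] \<beta>_closed \<beta>_closed e_closed[OF z(1)] c] nz
          r.A.degrees_addable(3)[OF e zz mem] by blast
      moreover have "z \<noteq> hzero A" using z v act_zero_right[OF v(1) \<beta>] by metis
      ultimately show False using c_not r.A.degrees_memI[OF e z(1) _ c] by blast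
    qed
    then show ?thesis using c_not act_zero_right[OF v(1) \<beta>] by (auto simp: component_def)
  qed
qed

text \<open>An element \<open>z\<close> representing \<open>v\<close> is a left identity modulo the
  kernel of \<open>coord\<close>. A submoduloid containing \<open>coord z\<close> therefore contains
  every \<open>coord a\<close>.\<close>

lemma coord_mul:
  assumes z: "z \<in> e" "act v \<beta> z = v" and a: "a \<in> carrier A"
  shows "coord (mul z \<beta> a) = coord a"
  using component_mul[OF z] r.mul_assoc[OF e_closed[OF z(1)] \<beta>_closed a] r.mul_closed a
  by (auto simp: coord_def fun_eq_iff)

text \<open>By irreducibility of \<open>V\<close>, the nonzero vector v\<beta>s can be moved back to
  \<open>v\<close>. This yields both a nonzero coordinate of \<open>s\<close> and a multiple of
  \<open>s\<close> to which \<open>coord_mul\<close> applies.\<close>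

lemma coord_nonzero:
  assumes s: "s \<in> e" "act v \<beta> s \<noteq> \<one>\<^bsub>V\<^esub>"
  obtains \<delta> c where "\<delta> \<in> carrier G" "c \<in> carrier A" "mul s \<delta> c \<in> e" "act v \<beta> (mul s \<delta> c) = v"
proof -
  obtain \<delta> where d: "\<delta> \<in> addible_set G \<alpha>" "act (act v \<beta> s) \<delta> ` e = carrier V"
    using V.cyclic[OF act_closed[OF v(1) \<beta> s(1)] s(2)] by (auto simp: on_set_def)
  then obtain c where c: "c \<in> e" "act (act v \<beta> s) \<delta> c = v" using v(1) by force
  then show ?thesis
    using that[of \<delta> c] act_assoc[OF v(1) \<beta> s(1) d(1) c(1)] mul_closed[OF s(1) d(1) c(1)]
      e_closed d by (simp add: addible_set_def)
qed

lemma coord_neq_zeroI: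
  assumes "\<delta> \<in> carrier G" "c \<in> carrier A" "mul s \<delta> c \<in> e" "act v \<beta> (mul s \<delta> c) = v"
  shows "coord s \<noteq> hzero induced"
proof -
  have "coord s (\<delta>, c) = v" using assms by (simp add: coord_def component_def)
  then show ?thesis using v by (auto simp: induced_def)
qed

text \<open>A nonzero function in a submoduloid has a nonzero coordinate; acting with that
  coordinate leads into \<open>e\<close>, and \<open>coord_nonzero\<close> leads on to a
  representative of \<open>v\<close>. By \<open>coord_mul\<close> the submoduloid is then
  everything.\<close>

lemma irreducible_induced: "irreducible_right_moduloid A G mul induced induced_act"
proof (intro irreducible_right_moduloid.intro irreducible_right_moduloid_axioms.intro)
  show "right_moduloid A G mul induced induced_act" by (rule right_moduloid_induced)
next
  \<comment> \<open>A representative \<open>u\<close> of \<open>v\<close> shows that the action is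
    nontrivial: \<open>coord u\<close> is nonzero and is fixed by acting with \<beta> and
    \<open>u\<close>.\<close>
  obtain u where u: "u \<in> e" "act v \<beta> u = v" using generates v(1) by force
  have uc: "u \<in> carrier A" using u e_closed by blast
  have "act v \<beta> u \<noteq> \<one>\<^bsub>V\<^esub>" using u v by simp
  then have "coord u \<noteq> hzero induced" using coord_nonzero[OF u(1)] coord_neq_zeroI by metis
  moreover have "coord u = induced_act (coord u) \<beta> u"
    using coord_mul[OF u uc] induced_act_coord[OF uc \<beta>_closed uc] by simp
  then have "coord u \<in> products induced_act (carrier induced) (carrier G) (carrier A)"
    using uc \<beta>_closed unfolding products_def carrier_induced by blast
  ultimately show "products induced_act (carrier induced) (carrier G) (carrier A) \<noteq> {hzero induced}"
    by blast
next
  fix N assume N: "submoduloid A G induced induced_act N"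
  then have N0: "N \<noteq> {}" "N \<subseteq> coord ` carrier A" by (auto simp: submoduloid_def carrier_induced)
  have Nact: "coord (mul a \<gamma> b) \<in> N"
    if "coord a \<in> N" "a \<in> carrier A" "\<gamma> \<in> carrier G" "b \<in> carrier A" for a \<gamma> b
    using N that induced_act_coord by (auto simp: submoduloid_def)
  have "N = carrier induced" if N1: "N \<noteq> {hzero induced}"
  proof -
    obtain f where f: "f \<in> N" "f \<noteq> hzero induced" using N0(1) N1 by blast
    then obtain w where w: "w \<in> carrier A" "f = coord w" using N0 by blast
    obtain p where p: "coord w p \<noteq> \<one>\<^bsub>V\<^esub>" using f w by (auto simp: induced_def fun_eq_iff simp del: split_paired_All split_paired_Ex)
    obtain \<gamma> b where p': "p = (\<gamma>, b)" by (cases p)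
    have g: "\<gamma> \<in> carrier G" "b \<in> carrier A" and "component (mul w \<gamma> b) \<noteq> \<one>\<^bsub>V\<^esub>"
      using p p' by (auto simp: coord_def split: if_splits)
    then have s: "mul w \<gamma> b \<in> e" "act v \<beta> (mul w \<gamma> b) \<noteq> \<one>\<^bsub>V\<^esub>"
      by (auto simp: component_def split: if_splits)
    obtain \<delta> c where d: "\<delta> \<in> carrier G" "c \<in> carrier A" "mul (mul w \<gamma> b) \<delta> c \<in> e"
      "act v \<beta> (mul (mul w \<gamma> b) \<delta> c) = v"
      by (rule coord_nonzero[OF s])
    have "coord (mul (mul w \<gamma> b) \<delta> c) \<in> N"
      using Nact f w g d r.mul_closed by blast
    then have "coord a \<in> N" if "a \<in> carrier A" for a
      using Nact[OF _ e_closed[OF d(3)] \<beta>_closed that] coord_mul[OF d(3,4) that] by simp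
    then show ?thesis using N0 by (auto simp: carrier_induced)
  qed
  then show "N = {hzero induced} \<or> N = carrier induced" by blast
qed

text \<open>If w\<gamma>y \<noteq> 0 with w = v\<beta>a, then v\<beta>(a\<gamma>y) \<noteq> 0, so
  \<open>coord (mul a \<gamma> y)\<close> is nonzero. But this is the action of \<gamma> and
  \<open>y\<close> on \<open>coord a\<close>, which vanishes.\<close>

lemma radical_annihilates:
  assumes y: "y \<in> anneid_radical A G mul" "y \<in> e"
  shows "y \<in> gamma_annihilator (on_set A e) (on_set G (addible_set G \<alpha>)) V act"
proof -
  have y0: "y \<in> moduloid_annihilator A G induced induced_act"
    by (rule anneid_radical_annihilates[OF y(1) irreducible_induced regular_induced])
  have ann: "act w \<gamma> y = \<one>\<^bsub>V\<^esub>" if w: "w \<in> carrier V" and \<gamma>: "\<gamma> \<in> addible_set G \<alpha>" for w \<gamma>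
  proof (rule ccontr)
    assume nz: "act w \<gamma> y \<noteq> \<one>\<^bsub>V\<^esub>"
    obtain a where a: "a \<in> e" "w = act v \<beta> a" using w generates by blast
    have \<gamma>c: "\<gamma> \<in> carrier G" using \<gamma> by (simp add: addible_set_def)
    have "act v \<beta> (mul a \<gamma> y) \<noteq> \<one>\<^bsub>V\<^esub>" using nz act_assoc[OF v(1) \<beta> a(1) \<gamma> y(2)] a by simp
    then obtain \<delta> c where "\<delta> \<in> carrier G" "c \<in> carrier A" "mul (mul a \<gamma> y) \<delta> c \<in> e"
      "act v \<beta> (mul (mul a \<gamma> y) \<delta> c) = v"
      using coord_nonzero[OF mul_closed[OF a(1) \<gamma> y(2)]] by metis
    then have "coord (mul a \<gamma> y) \<noteq> hzero induced" by (rule coord_neq_zeroI)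
    moreover have "induced_act (coord a) \<gamma> y
        \<in> products induced_act (carrier induced) (carrier G) {y}"
      using a e_closed \<gamma>c by (auto simp: products_def carrier_induced)
    then have "induced_act (coord a) \<gamma> y = hzero induced"
      using y0 by (simp add: moduloid_annihilator_def)
    ultimately show False
      using induced_act_coord[OF e_closed[OF a(1)] \<gamma>c e_closed[OF y(2)]] by simp
  qed
  have "v \<in> carrier V" "\<beta> \<in> addible_set G \<alpha>" using v \<beta> by auto
  then have "products act (carrier V) (addible_set G \<alpha>) {y} = {\<one>\<^bsub>V\<^esub>}"
    using ann by (force simp: products_def)
  then show ?thesis using y by (simp add: gamma_annihilator_def on_set_def)
qed

end

section \<open>Comparison of the radicals\<close>

text \<open>Each annihilator absorbs products on the right, as m\<delta>(x\<gamma>b) =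
  (m\<delta>x)\<gamma>b. Hence xGA stays in the radical.\<close>

lemma (in anneid) radical_mul:
  assumes x: "x \<in> anneid_radical A G mul" and \<gamma>: "\<gamma> \<in> carrier G" and b: "b \<in> carrier A"
  shows "mul x \<gamma> b \<in> anneid_radical A G mul"
proof -
  have xc: "x \<in> carrier A" using x by (simp add: anneid_radical_def)
  have "mul x \<gamma> b \<in> moduloid_annihilator A G M act"
    if M: "irreducible_right_moduloid A G mul M act" "regular_right_moduloid A G mul M act"
    for M :: "('g \<times> 'a) list homogroupoid" and act
  proof -
    interpret irreducible_right_moduloid A G mul M act by (rule M)
    have z: "products act (carrier M) (carrier G) {x} = {hzero M}"
      using x M by (simp add: anneid_radical_def moduloid_annihilator_def)
    have "act m \<delta> (mul x \<gamma> b) = hzero M" if m: "m \<in> carrier M" "\<delta> \<in> carrier G" for m \<delta>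
    proof -
      have "act m \<delta> x \<in> products act (carrier M) (carrier G) {x}" using m by (auto simp: products_def)
      then show ?thesis using z act_assoc[OF m xc \<gamma> b] act_zero[OF \<gamma> b] by simp
    qed
    then have "products act (carrier M) (carrier G) {mul x \<gamma> b} = {hzero M}"
      using M.zero_closed G.zero_closed by (force simp: products_def)
    then show ?thesis using mul_closed[OF xc \<gamma> b] by (simp add: moduloid_annihilator_def)
  qed
  then show ?thesis using mul_closed[OF xc \<gamma> b] by (auto simp: anneid_radical_def)
qed

text \<open>Cyclicity of an irreducible module over the component supplies \<open>v\<close> and
  \<beta>, so that \<open>radical_annihilates\<close> applies to its induced moduloid.\<close>

lemma radical_component:
  fixes A :: "'a homogroupoid" and G :: "'g homogroupoid"
  assumes reg: "regular_anneid A G mul" and y: "y \<in> anneid_radical A G mul" "y \<in> e"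
    and e: "e \<in> degrees A"
  shows "y \<in> gamma_radical (on_set A e) (on_set G (addible_set G \<alpha>)) mul"
proof -
  have "y \<in> gamma_annihilator (on_set A e) (on_set G (addible_set G \<alpha>)) V act"
    if V: "irreducible_gamma_module (on_set A e) (on_set G (addible_set G \<alpha>)) mul V act"
    for V :: "('g \<times> 'a) list monoid" and act
  proof -
    interpret V: irreducible_gamma_module "on_set A e" "on_set G (addible_set G \<alpha>)" mul V act
      by (rule V)
    obtain v where v: "v \<in> carrier V" "v \<noteq> \<one>\<^bsub>V\<^esub>"
      using V.nontrivial_actionE V.act_closed by metis
    obtain \<beta> where \<beta>: "\<beta> \<in> carrier (on_set G (addible_set G \<alpha>))"
      "act v \<beta> ` carrier (on_set A e) = carrier V"
      by (rule V.cyclic[OF v])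
    interpret induced_moduloid A G mul e \<alpha> V act v \<beta>
      using reg V e v \<beta>
      by (auto simp: regular_anneid_def on_set_def intro!: induced_moduloid.intro
            induced_moduloid_axioms.intro)
    show ?thesis using y by (rule radical_annihilates)
  qed
  then show ?thesis using y by (auto simp: gamma_radical_def on_set_def)
qed

lemma (in irreducible_regular_moduloid) annihilatorI:
  assumes x: "x \<in> carrier A"
    and rad: "\<And>\<gamma> e. \<lbrakk>\<gamma> \<in> carrier G; \<gamma> \<noteq> hzero G; alpha_idempotent A G mul \<gamma> e\<rbrakk> \<Longrightarrow>
      products mul {x} (carrier G) (carrier A) \<inter> e
        \<subseteq> gamma_radical (on_set A e) (on_set G (addible_set G \<gamma>)) mul"
  shows "x \<in> moduloid_annihilator A G M act"
proof -
  have "act w \<gamma> x = hzero M" if w: "w \<in> carrier M" and \<gamma>: "\<gamma> \<in> carrier G" for w \<gamma>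
  proof (rule ccontr)
    assume nz: "act w \<gamma> x \<noteq> hzero M"
    obtain \<delta> where d: "\<delta> \<in> carrier G" "act (act w \<gamma> x) \<delta> ` carrier A = carrier M"
      by (rule cyclic[OF act_closed[OF w \<gamma> x] nz])
    then obtain a where a: "a \<in> carrier A" "act (act w \<gamma> x) \<delta> a = w" using w by force
    define y where "y = mul x \<delta> a"
    have y: "y \<in> carrier A" "y \<in> products mul {x} (carrier G) (carrier A)"
      using a d x mul_closed by (auto simp: y_def products_def)
    have wy: "act w \<gamma> y = w" using act_assoc[OF w \<gamma> x d(1) a(1)] a by (simp add: y_def)
    have w0: "w \<noteq> hzero M" using nz act_zero \<gamma> x by blast
    have \<gamma>0: "\<gamma> \<noteq> hzero G" using wy w0 act_zero_mid[OF w y(1)] by auto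
    have y0: "y \<noteq> hzero A" using wy w0 act_zero_right[OF w \<gamma>] by auto
    have yyc: "mul y \<gamma> y \<in> carrier A" using y \<gamma> mul_closed by blast
    have wyy: "act w \<gamma> (mul y \<gamma> y) = w" using act_assoc[OF w \<gamma> y(1) \<gamma> y(1)] wy by simp
    have "mul y \<gamma> y \<noteq> hzero A" using wyy w0 act_zero_right[OF w \<gamma>] by auto
    \<comment> \<open>Acting through \<gamma>, both \<open>y\<close> and y\<gamma>y send
      \<open>w\<close> to \<open>w\<close>; equal nonzero values are addable, and regularity
      transfers this to \<open>A\<close>.\<close>
    moreover have "y \<sharp>\<^bsub>A\<^esub> mul y \<gamma> y"
      using regular[OF w \<gamma> \<gamma> y(1) yyc] wy wyy w0 M.addable_refl[OF w] by simp
    ultimately have id: "alpha_idempotent A G mul \<gamma> (addible_set A y)"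
      by (rule alpha_idempotentI[OF y(1) y0 \<gamma> \<gamma>0])
    have "y \<in> addible_set A y" using y A.addable_refl by (simp add: addible_set_def)
    then have "y \<in> gamma_radical (on_set A (addible_set A y)) (on_set G (addible_set G \<gamma>)) mul"
      using rad[OF \<gamma> \<gamma>0 id] y by blast
    then have "y \<in> gamma_annihilator (on_set A (addible_set A y)) (on_set G (addible_set G \<gamma>))
        (on_set M (addible_set M w)) act"
      by (rule gamma_radical_annihilates[OF _ irreducible_component[OF w w0 \<gamma> \<gamma>0 y(1) y0 wy id]])
    \<comment> \<open>The contradiction: w = w\<gamma>y is a nonzero product with an element that
      should annihilate the addibility group of \<open>w\<close>.\<close>
    moreover have "w \<in> products act (addible_set M w) (addible_set G \<gamma>) {y}"
      using wy w \<gamma> M.addable_refl G.addable_refl by (force simp: products_def addible_set_def)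
    ultimately show False using w0 by (simp add: gamma_annihilator_def on_set_def)
  qed
  then have "products act (carrier M) (carrier G) {x} = {hzero M}"
    using M.zero_closed G.zero_closed by (force simp: products_def)
  then show ?thesis using x by (simp add: moduloid_annihilator_def)
qed

theorem theorem7p4:
  fixes A :: "'a homogroupoid" and G :: "'g homogroupoid" and mul :: "'a \<Rightarrow> 'g \<Rightarrow> 'a \<Rightarrow> 'a"
  assumes "regular_anneid A G mul"
  shows "anneid_radical A G mul =
    {x \<in> carrier A. \<forall>\<alpha>\<in>carrier G. \<alpha> \<noteq> hzero G \<longrightarrow>
       (\<forall>e\<in>degrees A. alpha_idempotent A G mul \<alpha> e \<longrightarrow>
          products mul {x} (carrier G) (carrier A) \<inter> e
            \<subseteq> gamma_radical (on_set A e) (on_set G (addible_set G \<alpha>)) mul)}"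
  (is "_ = ?R")
proof (intro equalityI subsetI)
  interpret anneid A G mul using assms by (simp add: regular_anneid_def)
  fix x assume x: "x \<in> anneid_radical A G mul"
  then have "x \<in> carrier A" by (simp add: anneid_radical_def)
  moreover have "products mul {x} (carrier G) (carrier A) \<subseteq> anneid_radical A G mul"
    using radical_mul[OF x] by (auto simp: products_def)
  ultimately show "x \<in> ?R" using radical_component[OF assms] by blast
next
  fix x assume x: "x \<in> ?R"
  have "x \<in> moduloid_annihilator A G M act"
    if M: "irreducible_right_moduloid A G mul M act" "regular_right_moduloid A G mul M act"
    for M :: "('g \<times> 'a) list homogroupoid" and act
  proof -
    interpret irreducible_regular_moduloid A G mul M act
      by (intro irreducible_regular_moduloid.intro M)
    \<comment> \<open>\<open>annihilatorI\<close> ranges over all sets \<open>e\<close>; unfolding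
      \<open>alpha_idempotent\<close> recovers the membership in \<open>degrees A\<close> that the
      assumption on \<open>x\<close> asks for.\<close>
    show ?thesis
      by (rule annihilatorI) (use x in \<open>auto simp: alpha_idempotent_def\<close>)
  qed
  then show "x \<in> anneid_radical A G mul" using x by (auto simp: anneid_radical_def)
qed

end
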